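(* Let $\mathcal{F}_q(G)$ be a Hopf algebra with invertible antipode over a field of characteristic zero, let $(\mathcal{F}_q(K),\pi)$ be a quantum subgroup of $\mathcal{F}_q(G)$, and let $B_K=\{f\in\mathcal{F}_q(G) : (\pi\otimes\mathrm{id})\Delta_G(f)=1\otimes f\}$. Let $\rho_R:V\to V\otimes\mathcal{F}_q(K)$ be a right corepresentation of $\mathcal{F}_q(K)$ on $V$, and let $\mathcal{H}_R=\mathrm{ind}_K^G(\rho_R)$ be the space of the induced $\mathcal{F}_q(G)$-corepresentation. Suppose that $(\mathcal{F}_q(K),\pi)$ has a left section $\phi$. Then: (i) $\mathcal{F}_q(G)$ is isomorphic to $\mathcal{F}_q(K)\otimes B_K$ as a vector space; (ii) $\mathcal{H}_R$ is isomorphic to $V\otimes B_K$ as a $B_K$-module, both as a left module and as a right module.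
   Context: All vector spaces are over a fixed field of characteristic zero. A quantum subgroup of a Hopf algebra $A$ is a pair $(B,\pi)$ with $B$ a Hopf algebra and $\pi:A\to B$ a Hopf algebra epimorphism. A right corepresentation of a coalgebra $C$ on $V$ is a counital coassociative linear map $V\to V\otimes C$. Write $\Delta_G,\Delta_K$ for the coproducts of $\mathcal{F}_q(G),\mathcal{F}_q(K)$. The induced space is $\mathcal{H}_R=\{F\in V\otimes\mathcal{F}_q(G) : (\mathrm{id}\otimes L)(F)=(\rho_R\otimes\mathrm{id})(F)\}$, where $L=(\pi\otimes\mathrm{id})\circ\Delta_G$. It is a left and right $B_K$-module via the linear extensions of $b\cdot(v\otimes f)=v\otimes bf$ and $(v\otimes f)\cdot b=v\otimes fb$; $V\otimes B_K$ is a left and right $B_K$-module by multiplication on the factor $B_K$. Linear maps $f,g:\mathcal{F}_q(K)\to\mathcal{F}_q(G)$ have convolution product $(f*g)(k)=\sum_{(k)}f(k_{(1)})g(k_{(2)})$; $f$ is convolution invertible if there is $f^{-1}$ with $f*f^{-1}=f^{-1}*f=\varepsilon(\cdot)1$. A left section is a linear convolution invertible map $\phi:\mathcal{F}_q(K)\to\mathcal{F}_q(G)$ such that $\phi(1)=1$ and $(\pi\otimes\mathrm{id})\Delta_G\circ\phi=(\mathrm{id}\otimes\phi)\circ\Delta_K$. *)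

theory Defs
  imports Complex_Main "HOL-Library.Function_Algebras"
begin

text \<open>
  A vector space over the field \<open>'k\<close> is a type together with a scalar multiplication
  \<open>s\<close> satisfying \<^const>\<open>vector_space\<close>; subspaces are subsets of that type.
\<close>

definition linear_on ::
  "'a set \<Rightarrow> ('k::field \<Rightarrow> 'a::ab_group_add \<Rightarrow> 'a) \<Rightarrow> ('k \<Rightarrow> 'b::ab_group_add \<Rightarrow> 'b) \<Rightarrow> ('a \<Rightarrow> 'b) \<Rightarrow> bool"
  where "linear_on U s t f \<longleftrightarrow>
    (\<forall>x\<in>U. \<forall>y\<in>U. f (x + y) = f x + f y) \<and> (\<forall>c. \<forall>x\<in>U. f (s c x) = t c (f x))"

definition bilinear_map ::
  "('k::field \<Rightarrow> 'a::ab_group_add \<Rightarrow> 'a) \<Rightarrow> ('k \<Rightarrow> 'b::ab_group_add \<Rightarrow> 'b) \<Rightarrow>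
   ('k \<Rightarrow> 'c::ab_group_add \<Rightarrow> 'c) \<Rightarrow> ('a \<Rightarrow> 'b \<Rightarrow> 'c) \<Rightarrow> bool"
  where "bilinear_map s1 s2 s3 h \<longleftrightarrow>
    (\<forall>w. Vector_Spaces.linear s1 s3 (\<lambda>u. h u w)) \<and> (\<forall>u. Vector_Spaces.linear s2 s3 (h u))"


section \<open>Tensor products\<close>

text \<open>
  The tensor \<open>u \<otimes> w\<close> is realised as the evaluation functional \<open>\<beta> \<mapsto> \<beta>(u, w)\<close> on bilinear
  forms, and \<open>U \<otimes> W\<close> is the span of these functionals for \<open>u \<in> U\<close> and \<open>w \<in> W\<close>. That this
  is a tensor product of the (possibly infinite-dimensional) spaces \<open>U\<close> and \<open>W\<close> is the universal
  property proved in \<open>tensor_universal\<close> and \<open>tensor_unique\<close> below. In particular, for a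
  subspace \<open>U\<close> of a larger space the set \<open>U \<otimes> W\<close> is the tensor product of \<open>U\<close> and \<open>W\<close> themselves.
\<close>

type_synonym ('a, 'b, 'k) tensor = "('a \<Rightarrow> 'b \<Rightarrow> 'k) \<Rightarrow> 'k"

definition tscale :: "'k::field \<Rightarrow> ('a, 'b, 'k) tensor \<Rightarrow> ('a, 'b, 'k) tensor"
  where "tscale c t = (\<lambda>\<beta>. c * t \<beta>)"

definition tensor ::
  "('k::field \<Rightarrow> 'a::ab_group_add \<Rightarrow> 'a) \<Rightarrow> ('k \<Rightarrow> 'b::ab_group_add \<Rightarrow> 'b) \<Rightarrow> 'a \<Rightarrow> 'b \<Rightarrow> ('a, 'b, 'k) tensor"
  where "tensor s1 s2 u w = (\<lambda>\<beta>. if bilinear_map s1 s2 (*) \<beta> then \<beta> u w else 0)"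

definition tensor_space ::
  "('k::field \<Rightarrow> 'a::ab_group_add \<Rightarrow> 'a) \<Rightarrow> ('k \<Rightarrow> 'b::ab_group_add \<Rightarrow> 'b) \<Rightarrow> 'a set \<Rightarrow> 'b set \<Rightarrow>
   ('a, 'b, 'k) tensor set"
  where "tensor_space s1 s2 U W = module.span tscale {tensor s1 s2 u w | u w. u \<in> U \<and> w \<in> W}"

text \<open>
  The linear map \<open>\<Sum> u \<otimes> w \<mapsto> \<Sum> h u w\<close> induced by a bilinear map \<open>h\<close>
  (\<open>tensor_lift_linear\<close>, \<open>tensor_lift_tensor\<close>); its values are meaningful on the tensor
  product, that is, on \<open>tensor_space s1 s2 UNIV UNIV\<close>.
\<close>

definition tensor_lift ::
  "('k::field \<Rightarrow> 'a::ab_group_add \<Rightarrow> 'a) \<Rightarrow> ('k \<Rightarrow> 'b::ab_group_add \<Rightarrow> 'b) \<Rightarrow>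
   ('a \<Rightarrow> 'b \<Rightarrow> 'c::ab_group_add) \<Rightarrow> ('a, 'b, 'k) tensor \<Rightarrow> 'c"
  where "tensor_lift s1 s2 h t =
    (THE z. \<exists>xs. t = (\<Sum>(u, w)\<leftarrow>xs. tensor s1 s2 u w) \<and> z = (\<Sum>(u, w)\<leftarrow>xs. h u w))"

text \<open>\<open>f \<otimes> g\<close>, where \<open>s1, s2\<close> belong to the domains of \<open>f, g\<close> and \<open>s3, s4\<close> to their codomains.\<close>

definition tensor_map ::
  "('k::field \<Rightarrow> 'a::ab_group_add \<Rightarrow> 'a) \<Rightarrow> ('k \<Rightarrow> 'b::ab_group_add \<Rightarrow> 'b) \<Rightarrow>
   ('k \<Rightarrow> 'c::ab_group_add \<Rightarrow> 'c) \<Rightarrow> ('k \<Rightarrow> 'd::ab_group_add \<Rightarrow> 'd) \<Rightarrow>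
   ('a \<Rightarrow> 'c) \<Rightarrow> ('b \<Rightarrow> 'd) \<Rightarrow> ('a, 'b, 'k) tensor \<Rightarrow> ('c, 'd, 'k) tensor"
  where "tensor_map s1 s2 s3 s4 f g = tensor_lift s1 s2 (\<lambda>u w. tensor s3 s4 (f u) (g w))"

text \<open>
  For \<open>f : U \<rightarrow> X \<otimes> Y\<close>, the map \<open>f \<otimes> id\<close> on \<open>U \<otimes> W\<close> followed by the canonical identification
  \<open>(X \<otimes> Y) \<otimes> W = X \<otimes> (Y \<otimes> W)\<close>; here \<open>s1, s2, s3, s4\<close> belong to \<open>U, W, X, Y\<close>.
\<close>

definition tensor_map_assoc ::
  "('k::field \<Rightarrow> 'a::ab_group_add \<Rightarrow> 'a) \<Rightarrow> ('k \<Rightarrow> 'b::ab_group_add \<Rightarrow> 'b) \<Rightarrow>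
   ('k \<Rightarrow> 'c::ab_group_add \<Rightarrow> 'c) \<Rightarrow> ('k \<Rightarrow> 'd::ab_group_add \<Rightarrow> 'd) \<Rightarrow>
   ('a \<Rightarrow> ('c, 'd, 'k) tensor) \<Rightarrow> ('a, 'b, 'k) tensor \<Rightarrow> ('c, ('d, 'b, 'k) tensor, 'k) tensor"
  where "tensor_map_assoc s1 s2 s3 s4 f =
    tensor_lift s1 s2
      (\<lambda>u w. tensor_lift s3 s4 (\<lambda>x y. tensor s3 tscale x (tensor s4 s2 y w)) (f u))"

text \<open>The product \<open>(a \<otimes> b)(c \<otimes> d) = ac \<otimes> bd\<close> on the tensor product of two algebras.\<close>

definition tensor_mult ::
  "('k::field \<Rightarrow> 'a::ring_1 \<Rightarrow> 'a) \<Rightarrow> ('k \<Rightarrow> 'b::ring_1 \<Rightarrow> 'b) \<Rightarrow>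
   ('a, 'b, 'k) tensor \<Rightarrow> ('a, 'b, 'k) tensor \<Rightarrow> ('a, 'b, 'k) tensor"
  where "tensor_mult s1 s2 x y =
    tensor_lift s1 s2
      (\<lambda>a b. tensor_lift s1 s2 (\<lambda>c d. tensor s1 s2 (a * c) (b * d)) y) x"


subsection \<open>Universal property\<close>

lemma vector_space_tscale: "vector_space (tscale :: 'k::field \<Rightarrow> ('a, 'b, 'k) tensor \<Rightarrow> _)"
  by unfold_locales (auto simp: tscale_def fun_eq_iff algebra_simps)

interpretation tensor: vector_space "tscale :: 'k::field \<Rightarrow> ('a, 'b, 'k) tensor \<Rightarrow> _"
  by (rule vector_space_tscale)

lemma bilinear_mapD:
  assumes "bilinear_map s1 s2 s3 h"
  shows "h (x + y) w = h x w + h y w" "h u (v + w) = h u v + h u w"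
    "h (s1 c u) w = s3 c (h u w)" "h u (s2 c w) = s3 c (h u w)"
  using assms unfolding bilinear_map_def Vector_Spaces.linear_iff by auto

lemma bilinear_map_tensor:
  assumes "vector_space s1" "vector_space s2"
  shows "bilinear_map s1 s2 tscale (tensor s1 s2)"
proof -
  have "tensor s1 s2 (x + y) w = tensor s1 s2 x w + tensor s1 s2 y w"
    "tensor s1 s2 u (v + w) = tensor s1 s2 u v + tensor s1 s2 u w"
    "tensor s1 s2 (s1 c u) w = tscale c (tensor s1 s2 u w)"
    "tensor s1 s2 u (s2 c w) = tscale c (tensor s1 s2 u w)" for x y u v w c
    unfolding tensor_def tscale_def
    by (rule ext, simp, blast dest: bilinear_mapD)+
  then show ?thesis
    using assms vector_space_tscale unfolding bilinear_map_def Vector_Spaces.linear_iff by blast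
qed

lemma tensor_sum_list_eval:
  assumes "bilinear_map s1 s2 (*) \<beta>"
  shows "(\<Sum>(u, w)\<leftarrow>xs. tensor s1 s2 u w) \<beta> = (\<Sum>(u, w)\<leftarrow>xs. \<beta> u w)"
  using assms by (induction xs) (auto simp: tensor_def)

lemma linear_sum_list:
  assumes "Vector_Spaces.linear s t f"
  shows "f (\<Sum>(u, w)\<leftarrow>xs. h u w) = (\<Sum>(u, w)\<leftarrow>xs. f (h u w))"
proof -
  interpret Vector_Spaces.linear s t f by fact
  show ?thesis by (induction xs) (auto simp: add)
qed

lemma functional_separates:
  fixes s :: "'k::field \<Rightarrow> 'a::ab_group_add \<Rightarrow> 'a"
  assumes "vector_space s" "\<And>f. Vector_Spaces.linear s (*) f \<Longrightarrow> f x = f y"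
  shows "x = y"
proof (rule ccontr)
  assume "x \<noteq> y"
  interpret vector_space s by fact
  interpret K: vector_space "(*) :: 'k \<Rightarrow> 'k \<Rightarrow> 'k"
    by unfold_locales (auto simp: algebra_simps)
  interpret P: vector_space_pair s "(*) :: 'k \<Rightarrow> 'k \<Rightarrow> 'k" ..
  have "independent {x - y}" using \<open>x \<noteq> y\<close> by simp
  from P.linear_independent_extend[OF this, of "\<lambda>_. 1"]
  obtain f where f: "Vector_Spaces.linear s (*) f" "f (x - y) = 1" by auto
  then have "f x - f y = 1" by (metis Vector_Spaces.linear.axioms(3) module_hom.diff)
  with assms(2)[OF f(1)] show False by simp
qed

lemma bilinear_sum_list_well_defined:
  assumes h: "bilinear_map s1 s2 s3 h"
    and eq: "(\<Sum>(u, w)\<leftarrow>xs. tensor s1 s2 u w) = (\<Sum>(u, w)\<leftarrow>ys. tensor s1 s2 u w)"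
  shows "(\<Sum>(u, w)\<leftarrow>xs. h u w) = (\<Sum>(u, w)\<leftarrow>ys. h u w)"
proof (rule functional_separates)
  show "vector_space s3" using h unfolding bilinear_map_def Vector_Spaces.linear_iff by blast
  fix f assume f: "Vector_Spaces.linear s3 (*) f"
  have "bilinear_map s1 s2 (*) (\<lambda>u w. f (h u w))"
    using h f unfolding bilinear_map_def Vector_Spaces.linear_iff by auto
  from tensor_sum_list_eval[OF this, of xs] tensor_sum_list_eval[OF this, of ys]
  show "f (\<Sum>(u, w)\<leftarrow>xs. h u w) = f (\<Sum>(u, w)\<leftarrow>ys. h u w)"
    unfolding linear_sum_list[OF f] eq by simp
qed

lemma tensor_lift_sum_list:
  assumes "bilinear_map s1 s2 s3 h"
  shows "tensor_lift s1 s2 h (\<Sum>(u, w)\<leftarrow>xs. tensor s1 s2 u w) = (\<Sum>(u, w)\<leftarrow>xs. h u w)"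
  unfolding tensor_lift_def
proof (rule the_equality)
  fix z assume "\<exists>ys. (\<Sum>(u, w)\<leftarrow>xs. tensor s1 s2 u w) = (\<Sum>(u, w)\<leftarrow>ys. tensor s1 s2 u w) \<and>
    z = (\<Sum>(u, w)\<leftarrow>ys. h u w)"
  then obtain ys where
    ys: "(\<Sum>(u, w)\<leftarrow>xs. tensor s1 s2 u w) = (\<Sum>(u, w)\<leftarrow>ys. tensor s1 s2 u w)"
      and z: "z = (\<Sum>(u, w)\<leftarrow>ys. h u w)" by (elim exE conjE)
  show "z = (\<Sum>(u, w)\<leftarrow>xs. h u w)"
    unfolding z by (rule bilinear_sum_list_well_defined[OF assms ys, symmetric])
qed (rule exI[of _ xs], rule conjI[OF refl refl])

lemma tensor_lift_tensor:
  assumes "bilinear_map s1 s2 s3 h"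
  shows "tensor_lift s1 s2 h (tensor s1 s2 u w) = h u w"
  using tensor_lift_sum_list[OF assms, of "[(u, w)]"] by simp

lemma tensor_space_sum_list:
  assumes "vector_space s1" "vector_space s2" "t \<in> tensor_space s1 s2 U W"
    and "module.subspace s1 U"
  shows "\<exists>xs. set xs \<subseteq> U \<times> W \<and> t = (\<Sum>(u, w)\<leftarrow>xs. tensor s1 s2 u w)"
  using assms(3) unfolding tensor_space_def
proof (induction rule: tensor.span_induct_alt)
  case base
  show ?case by (rule exI[of _ "[]"]) simp
next
  case (step c x y)
  interpret s1: vector_space s1 by fact
  from step obtain u w xs where
    "x = tensor s1 s2 u w" "u \<in> U" "w \<in> W" "set xs \<subseteq> U \<times> W"
    "y = (\<Sum>(u, w)\<leftarrow>xs. tensor s1 s2 u w)" by auto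
  then show ?case
    using s1.subspace_scale[OF assms(4)] bilinear_mapD(3)[OF bilinear_map_tensor[OF assms(1,2)]]
    by (intro exI[of _ "(s1 c u, w) # xs"]) auto
qed

lemma tensor_lift_linear:
  assumes h: "bilinear_map s1 s2 s3 h"
  shows "linear_on (tensor_space s1 s2 UNIV UNIV) tscale s3 (tensor_lift s1 s2 h)"
proof -
  from h have vs: "vector_space s1" "vector_space s2" "vector_space s3"
    unfolding bilinear_map_def Vector_Spaces.linear_iff by auto
  interpret s1: vector_space s1 by fact
  interpret s3: vector_space s3 by fact
  have rep: "\<exists>xs. t = (\<Sum>(u, w)\<leftarrow>xs. tensor s1 s2 u w)"
    if "t \<in> tensor_space s1 s2 UNIV UNIV" for t
    using tensor_space_sum_list[OF vs(1,2) that s1.subspace_UNIV] by blast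
  note tl = tensor_lift_sum_list[OF h]
  show ?thesis unfolding linear_on_def
  proof (intro conjI ballI allI)
    fix x y assume "x \<in> tensor_space s1 s2 UNIV UNIV" "y \<in> tensor_space s1 s2 UNIV UNIV"
    then obtain xs ys where
      "x = (\<Sum>(u, w)\<leftarrow>xs. tensor s1 s2 u w)" "y = (\<Sum>(u, w)\<leftarrow>ys. tensor s1 s2 u w)"
      using rep by metis
    then show "tensor_lift s1 s2 h (x + y) = tensor_lift s1 s2 h x + tensor_lift s1 s2 h y"
      using tl[of xs] tl[of ys] tl[of "xs @ ys"] by simp
  next
    fix c x assume "x \<in> tensor_space s1 s2 UNIV UNIV"
    then obtain xs where x: "x = (\<Sum>(u, w)\<leftarrow>xs. tensor s1 s2 u w)" using rep by metis
    let ?ys = "map (\<lambda>(u, w). (s1 c u, w)) xs"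
    have "(\<Sum>(u, w)\<leftarrow>?ys. tensor s1 s2 u w) = tscale c x"
      unfolding x
      by (induction xs)
        (auto simp: tscale_def fun_eq_iff distrib_left bilinear_mapD(3)[OF bilinear_map_tensor[OF vs(1,2)]])
    moreover have "(\<Sum>(u, w)\<leftarrow>?ys. h u w) = s3 c (\<Sum>(u, w)\<leftarrow>xs. h u w)"
      by (induction xs) (auto simp: s3.scale_right_distrib bilinear_mapD(3)[OF h])
    ultimately show "tensor_lift s1 s2 h (tscale c x) = s3 c (tensor_lift s1 s2 h x)"
      using tl[of ?ys] tl[of xs] x by simp
  qed
qed

theorem tensor_universal:
  assumes "vector_space s1" "vector_space s2" "vector_space s3"
    and U: "module.subspace s1 U" and W: "module.subspace s2 W"
    and h1: "\<And>w. w \<in> W \<Longrightarrow> linear_on U s1 s3 (\<lambda>u. h u w)"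
    and h2: "\<And>u. u \<in> U \<Longrightarrow> linear_on W s2 s3 (h u)"
  shows "\<exists>g. linear_on (tensor_space s1 s2 U W) tscale s3 g \<and>
    (\<forall>u\<in>U. \<forall>w\<in>W. g (tensor s1 s2 u w) = h u w)"
proof -
  interpret s1: vector_space s1 by fact
  interpret s2: vector_space s2 by fact
  interpret s3: vector_space s3 by fact
  interpret P1: vector_space_pair s1 s1 ..
  interpret P2: vector_space_pair s2 s2 ..
  obtain p where p: "range p \<subseteq> U" "Vector_Spaces.linear s1 s1 p" "\<And>u. u \<in> U \<Longrightarrow> p u = u"
    using P1.linear_exists_right_inverse_on[OF s1.linear_id U] by auto
  obtain q where q: "range q \<subseteq> W" "Vector_Spaces.linear s2 s2 q" "\<And>w. w \<in> W \<Longrightarrow> q w = w"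
    using P2.linear_exists_right_inverse_on[OF s2.linear_id W] by auto
  have pU: "p u \<in> U" and qW: "q w \<in> W" for u w using p(1) q(1) by auto
  let ?h = "\<lambda>u w. h (p u) (q w)"
  have bil: "bilinear_map s1 s2 s3 ?h"
    using p(2) q(2) h1[OF qW] h2[OF pU] pU qW assms(1-3)
    unfolding bilinear_map_def Vector_Spaces.linear_iff linear_on_def by auto
  have "tensor_space s1 s2 U W \<subseteq> tensor_space s1 s2 UNIV UNIV"
    unfolding tensor_space_def by (rule tensor.span_mono) auto
  with tensor_lift_linear[OF bil]
  have "linear_on (tensor_space s1 s2 U W) tscale s3 (tensor_lift s1 s2 ?h)"
    unfolding linear_on_def by (meson subsetD)
  moreover have "tensor_lift s1 s2 ?h (tensor s1 s2 u w) = h u w" if "u \<in> U" "w \<in> W" for u w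
    using that tensor_lift_tensor[OF bil] p(3) q(3) by simp
  ultimately show ?thesis by blast
qed

theorem tensor_unique:
  assumes "vector_space s1" "vector_space s2" "vector_space s3"
    and "linear_on (tensor_space s1 s2 U W) tscale s3 f"
    and "linear_on (tensor_space s1 s2 U W) tscale s3 g"
    and "\<And>u w. u \<in> U \<Longrightarrow> w \<in> W \<Longrightarrow> f (tensor s1 s2 u w) = g (tensor s1 s2 u w)"
    and t: "t \<in> tensor_space s1 s2 U W"
  shows "f t = g t"
proof -
  interpret s3: vector_space s3 by fact
  define S where "S = {tensor s1 s2 u w | u w. u \<in> U \<and> w \<in> W}"
  have T: "tensor_space s1 s2 U W = tensor.span S"
    by (simp only: tensor_space_def S_def)
  note add = assms(4,5)[unfolded linear_on_def T, THEN conjunct1, rule_format]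
  note scale = assms(4,5)[unfolded linear_on_def T, THEN conjunct2, rule_format]
  have z: "f 0 = 0" "g 0 = 0"
    using scale[OF tensor.span_zero, of 0]
    by (simp_all only: tensor.scale_zero_left s3.scale_zero_left)
  from t have "t \<in> tensor.span S \<and> f t = g t"
    unfolding T
  proof (induction rule: tensor.span_induct_alt)
    case base
    show ?case using z tensor.span_zero by metis
  next
    case (step c x y)
    have x: "x \<in> tensor.span S" by (rule tensor.span_base[OF step(1)])
    have cx: "tscale c x \<in> tensor.span S" by (rule tensor.span_scale[OF x])
    have "f x = g x" using step(1) assms(6) unfolding S_def by blast
    then have "f (tscale c x) = g (tscale c x)" by (simp only: scale[OF x])
    with step(2) have "f (tscale c x + y) = g (tscale c x + y)"
      by (simp only: add[OF cx])
    with step(2) cx show ?case by (blast intro: tensor.span_add)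
  qed
  then show ?thesis ..
qed


lemma tensor_map_tensor:
  assumes f: "Vector_Spaces.linear s1 s3 f" and g: "Vector_Spaces.linear s2 s4 g"
  shows "tensor_map s1 s2 s3 s4 f g (tensor s1 s2 u w) = tensor s3 s4 (f u) (g w)"
proof -
  note vs = f[unfolded Vector_Spaces.linear_iff] g[unfolded Vector_Spaces.linear_iff]
  from vs have v: "vector_space s1" "vector_space s2" "vector_space s3" "vector_space s4" by blast+
  note b = bilinear_mapD[OF bilinear_map_tensor[OF v(3,4)]]
  from vs have eqs: "f (x + y) = f x + f y" "f (s1 c x) = s3 c (f x)"
    "g (x' + y') = g x' + g y'" "g (s2 c x') = s4 c (g x')" for x y x' y' c by blast+
  have "bilinear_map s1 s2 tscale (\<lambda>u w. tensor s3 s4 (f u) (g w))"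
    unfolding bilinear_map_def Vector_Spaces.linear_iff
    by (intro allI conjI v vector_space_tscale) (simp_all only: eqs b)
  from tensor_lift_tensor[OF this] show ?thesis unfolding tensor_map_def .
qed

lemma tensor_map_assoc_tensor:
  assumes f: "Vector_Spaces.linear s1 tscale f" and f_in: "\<And>u. f u \<in> tensor_space s3 s4 UNIV UNIV"
    and v: "vector_space s2" "vector_space s3" "vector_space s4"
    and fu: "f u = (\<Sum>(x, y)\<leftarrow>xs. tensor s3 s4 x y)"
  shows "tensor_map_assoc s1 s2 s3 s4 f (tensor s1 s2 u w) =
    (\<Sum>(x, y)\<leftarrow>xs. tensor s3 tscale x (tensor s4 s2 y w))"
proof -
  let ?h = "\<lambda>w x y. tensor s3 tscale x (tensor s4 s2 y w)"
  let ?H = "\<lambda>u w. tensor_lift s3 s4 (?h w) (f u)"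
  note b1 = bilinear_mapD[OF bilinear_map_tensor[OF v(2) vector_space_tscale]]
  note b2 = bilinear_mapD[OF bilinear_map_tensor[OF v(3) v(1)]]
  have bil: "bilinear_map s3 s4 tscale (?h w)" for w
    unfolding bilinear_map_def Vector_Spaces.linear_iff
    by (intro allI conjI v vector_space_tscale) (simp_all only: b1 b2)
  note lift = tensor_lift_sum_list[OF bil]
  note lin = tensor_lift_linear[OF bil, unfolded linear_on_def]
  from f have vs1: "vector_space s1" and fadd: "\<And>x y. f (x + y) = f x + f y"
    and fscale: "\<And>c x. f (s1 c x) = tscale c (f x)"
    unfolding Vector_Spaces.linear_iff by blast+
  interpret s3: vector_space s3 by (rule v)
  have rep: "\<exists>ys. f u = (\<Sum>(x, y)\<leftarrow>ys. tensor s3 s4 x y)" for u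
    using tensor_space_sum_list[OF v(2,3) f_in s3.subspace_UNIV] by blast
  have "Vector_Spaces.linear s1 tscale (\<lambda>u. ?H u w)" for w
    unfolding Vector_Spaces.linear_iff
  proof (intro conjI allI vs1 vector_space_tscale)
    show "?H (x + y) w = ?H x w + ?H y w" for x y
      unfolding fadd by (rule lin[THEN conjunct1, rule_format, OF f_in f_in])
    show "?H (s1 c x) w = tscale c (?H x w)" for c x
      unfolding fscale by (rule lin[THEN conjunct2, rule_format, OF f_in])
  qed
  moreover have "Vector_Spaces.linear s2 tscale (?H u)" for u
    unfolding Vector_Spaces.linear_iff
  proof (intro conjI allI v vector_space_tscale)
    obtain ys where ys: "f u = (\<Sum>(x, y)\<leftarrow>ys. tensor s3 s4 x y)" using rep by blast
    show "?H u (w + w') = ?H u w + ?H u w'" for w w'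
      unfolding ys lift unfolding b2 b1
      by (simp only: case_prod_unfold sum_list_addf)
    show "?H u (s2 c w) = tscale c (?H u w)" for c w
      unfolding ys lift unfolding b2 b1
    proof (induction ys)
      case Nil
      show ?case by (simp only: list.map sum_list.Nil tensor.scale_zero_right)
    next
      case (Cons p ys)
      then show ?case
        by (simp only: list.map sum_list.Cons case_prod_unfold tensor.scale_right_distrib)
    qed
  qed
  ultimately have "bilinear_map s1 s2 tscale ?H" unfolding bilinear_map_def by blast
  from tensor_lift_tensor[OF this] show ?thesis
    unfolding tensor_map_assoc_def by (simp only: fu lift)
qed


section \<open>Hopf algebras\<close>

locale coalgebra = vector_space scale
  for scale :: "'k::field \<Rightarrow> 'a::ab_group_add \<Rightarrow> 'a" +
  fixes comult :: "'a \<Rightarrow> ('a, 'a, 'k) tensor"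
    and counit :: "'a \<Rightarrow> 'k"
  assumes comult_linear: "Vector_Spaces.linear scale tscale comult"
    and comult_in: "comult a \<in> tensor_space scale scale UNIV UNIV"
    and counit_linear: "Vector_Spaces.linear scale (*) counit"
    and coassoc: "tensor_map_assoc scale scale scale scale comult (comult a)
      = tensor_map scale scale scale tscale id comult (comult a)"
    and counit_left: "tensor_lift scale scale (\<lambda>x y. scale (counit x) y) (comult a) = a"
    and counit_right: "tensor_lift scale scale (\<lambda>x y. scale (counit y) x) (comult a) = a"

locale hopf_algebra = coalgebra scale comult counit
  for scale :: "'k::field \<Rightarrow> 'a::ring_1 \<Rightarrow> 'a"
    and comult :: "'a \<Rightarrow> ('a, 'a, 'k) tensor"
    and counit :: "'a \<Rightarrow> 'k" +
  fixes antipode :: "'a \<Rightarrow> 'a"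
  assumes scale_mult_left: "scale c x * y = scale c (x * y)"
    and scale_mult_right: "x * scale c y = scale c (x * y)"
    and comult_mult: "comult (x * y) = tensor_mult scale scale (comult x) (comult y)"
    and comult_one: "comult 1 = tensor scale scale 1 1"
    and counit_mult: "counit (x * y) = counit x * counit y"
    and counit_one: "counit 1 = 1"
    and antipode_linear: "Vector_Spaces.linear scale scale antipode"
    and antipode_left:
      "tensor_lift scale scale (\<lambda>x y. antipode x * y) (comult a) = scale (counit a) 1"
    and antipode_right:
      "tensor_lift scale scale (\<lambda>x y. x * antipode y) (comult a) = scale (counit a) 1"

locale quantum_subgroup =
  G: hopf_algebra sG \<Delta>G \<epsilon>G SG + K: hopf_algebra sK \<Delta>K \<epsilon>K SK
  for sG :: "'k::field \<Rightarrow> 'g::ring_1 \<Rightarrow> 'g" and \<Delta>G \<epsilon>G SG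
    and sK :: "'k \<Rightarrow> 'h::ring_1 \<Rightarrow> 'h" and \<Delta>K \<epsilon>K SK +
  fixes \<pi> :: "'g \<Rightarrow> 'h"
  assumes proj_linear: "Vector_Spaces.linear sG sK \<pi>"
    and proj_mult: "\<pi> (x * y) = \<pi> x * \<pi> y"
    and proj_one: "\<pi> 1 = 1"
    and proj_comult: "\<Delta>K (\<pi> x) = tensor_map sG sG sK sK \<pi> \<pi> (\<Delta>G x)"
    and proj_counit: "\<epsilon>K (\<pi> x) = \<epsilon>G x"
    and proj_antipode: "\<pi> (SG x) = SK (\<pi> x)"
    and proj_surj: "surj \<pi>"

locale right_corepresentation =
  V: vector_space sV + C: coalgebra sC \<Delta> \<epsilon>
  for sV :: "'k::field \<Rightarrow> 'v::ab_group_add \<Rightarrow> 'v"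
    and sC :: "'k \<Rightarrow> 'c::ab_group_add \<Rightarrow> 'c" and \<Delta> \<epsilon> +
  fixes \<rho> :: "'v \<Rightarrow> ('v, 'c, 'k) tensor"
  assumes coact_linear: "Vector_Spaces.linear sV tscale \<rho>"
    and coact_in: "\<rho> v \<in> tensor_space sV sC UNIV UNIV"
    and coact_coassoc:
      "tensor_map_assoc sV sC sV sC \<rho> (\<rho> v) = tensor_map sV sC sV tscale id \<Delta> (\<rho> v)"
    and coact_counit: "tensor_lift sV sC (\<lambda>w c. sV (\<epsilon> c) w) (\<rho> v) = v"


section \<open>Induction and left sections\<close>

text \<open>\<open>L = (\<pi> \<otimes> id) \<circ> \<Delta>\<^sub>G\<close>\<close>

definition left_coaction ::
  "('k::field \<Rightarrow> 'g::ring_1 \<Rightarrow> 'g) \<Rightarrow> ('g \<Rightarrow> ('g, 'g, 'k) tensor) \<Rightarrow>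
   ('k \<Rightarrow> 'h::ring_1 \<Rightarrow> 'h) \<Rightarrow> ('g \<Rightarrow> 'h) \<Rightarrow> 'g \<Rightarrow> ('h, 'g, 'k) tensor"
  where "left_coaction sG \<Delta>G sK \<pi> f = tensor_map sG sG sK sG \<pi> id (\<Delta>G f)"

definition coinvariants ::
  "('k::field \<Rightarrow> 'g::ring_1 \<Rightarrow> 'g) \<Rightarrow> ('g \<Rightarrow> ('g, 'g, 'k) tensor) \<Rightarrow>
   ('k \<Rightarrow> 'h::ring_1 \<Rightarrow> 'h) \<Rightarrow> ('g \<Rightarrow> 'h) \<Rightarrow> 'g set"
  where "coinvariants sG \<Delta>G sK \<pi> = {f. left_coaction sG \<Delta>G sK \<pi> f = tensor sK sG 1 f}"

definition induced_space ::
  "('k::field \<Rightarrow> 'g::ring_1 \<Rightarrow> 'g) \<Rightarrow> ('g \<Rightarrow> ('g, 'g, 'k) tensor) \<Rightarrow>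
   ('k \<Rightarrow> 'h::ring_1 \<Rightarrow> 'h) \<Rightarrow> ('g \<Rightarrow> 'h) \<Rightarrow>
   ('k \<Rightarrow> 'v::ab_group_add \<Rightarrow> 'v) \<Rightarrow> ('v \<Rightarrow> ('v, 'h, 'k) tensor) \<Rightarrow> ('v, 'g, 'k) tensor set"
  where "induced_space sG \<Delta>G sK \<pi> sV \<rho> =
    {F \<in> tensor_space sV sG UNIV UNIV.
      tensor_map sV sG sV tscale id (left_coaction sG \<Delta>G sK \<pi>) F
        = tensor_map_assoc sV sG sV sK \<rho> F}"

definition convolution ::
  "('k::field \<Rightarrow> 'c::ab_group_add \<Rightarrow> 'c) \<Rightarrow> ('c \<Rightarrow> ('c, 'c, 'k) tensor) \<Rightarrow>
   ('c \<Rightarrow> 'a::ring_1) \<Rightarrow> ('c \<Rightarrow> 'a) \<Rightarrow> 'c \<Rightarrow> 'a"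
  where "convolution sC \<Delta> f g k = tensor_lift sC sC (\<lambda>x y. f x * g y) (\<Delta> k)"

definition convolution_invertible ::
  "('k::field \<Rightarrow> 'c::ab_group_add \<Rightarrow> 'c) \<Rightarrow> ('c \<Rightarrow> ('c, 'c, 'k) tensor) \<Rightarrow> ('c \<Rightarrow> 'k) \<Rightarrow>
   ('k \<Rightarrow> 'a::ring_1 \<Rightarrow> 'a) \<Rightarrow> ('c \<Rightarrow> 'a) \<Rightarrow> bool"
  where "convolution_invertible sC \<Delta> \<epsilon> sA f \<longleftrightarrow>
    (\<exists>g. Vector_Spaces.linear sC sA g \<and>
      convolution sC \<Delta> f g = (\<lambda>k. sA (\<epsilon> k) 1) \<and>
      convolution sC \<Delta> g f = (\<lambda>k. sA (\<epsilon> k) 1))"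

definition left_section ::
  "('k::field \<Rightarrow> 'g::ring_1 \<Rightarrow> 'g) \<Rightarrow> ('g \<Rightarrow> ('g, 'g, 'k) tensor) \<Rightarrow>
   ('k \<Rightarrow> 'h::ring_1 \<Rightarrow> 'h) \<Rightarrow> ('h \<Rightarrow> ('h, 'h, 'k) tensor) \<Rightarrow> ('h \<Rightarrow> 'k) \<Rightarrow>
   ('g \<Rightarrow> 'h) \<Rightarrow> ('h \<Rightarrow> 'g) \<Rightarrow> bool"
  where "left_section sG \<Delta>G sK \<Delta>K \<epsilon>K \<pi> \<phi> \<longleftrightarrow>
    Vector_Spaces.linear sK sG \<phi> \<and>
    convolution_invertible sK \<Delta>K \<epsilon>K sG \<phi> \<and>
    \<phi> 1 = 1 \<and>
    (\<forall>k. left_coaction sG \<Delta>G sK \<pi> (\<phi> k) = tensor_map sK sK sK sG id \<phi> (\<Delta>K k))"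


section \<open>Isomorphisms\<close>

definition vs_iso ::
  "('k::field \<Rightarrow> 'a::ab_group_add \<Rightarrow> 'a) \<Rightarrow> 'a set \<Rightarrow> ('k \<Rightarrow> 'b::ab_group_add \<Rightarrow> 'b) \<Rightarrow> 'b set \<Rightarrow>
   ('a \<Rightarrow> 'b) \<Rightarrow> bool"
  where "vs_iso s X t Y f \<longleftrightarrow> linear_on X s t f \<and> bij_betw f X Y"

text \<open>\<open>b\<cdot>(v \<otimes> f) = v \<otimes> bf\<close> and \<open>(v \<otimes> f)\<cdot>b = v \<otimes> fb\<close>\<close>

definition act_left ::
  "('k::field \<Rightarrow> 'v::ab_group_add \<Rightarrow> 'v) \<Rightarrow> ('k \<Rightarrow> 'g::ring_1 \<Rightarrow> 'g) \<Rightarrow>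
   'g \<Rightarrow> ('v, 'g, 'k) tensor \<Rightarrow> ('v, 'g, 'k) tensor"
  where "act_left sV sG b = tensor_map sV sG sV sG id (\<lambda>f. b * f)"

definition act_right ::
  "('k::field \<Rightarrow> 'v::ab_group_add \<Rightarrow> 'v) \<Rightarrow> ('k \<Rightarrow> 'g::ring_1 \<Rightarrow> 'g) \<Rightarrow>
   'g \<Rightarrow> ('v, 'g, 'k) tensor \<Rightarrow> ('v, 'g, 'k) tensor"
  where "act_right sV sG b = tensor_map sV sG sV sG id (\<lambda>f. f * b)"

text \<open>
  Isomorphism of subspaces \<open>X\<close>, \<open>Y\<close> of \<open>V \<otimes> A\<close> as modules under \<open>act\<close> restricted to \<open>B\<close>.
  Stability of \<open>X\<close> and \<open>Y\<close> is included because \<open>act\<close> is defined on all of \<open>V \<otimes> A\<close>.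
\<close>

definition module_iso ::
  "'g set \<Rightarrow> ('g \<Rightarrow> ('v, 'g, 'k::field) tensor \<Rightarrow> ('v, 'g, 'k) tensor) \<Rightarrow>
   ('v, 'g, 'k) tensor set \<Rightarrow> ('v, 'g, 'k) tensor set \<Rightarrow>
   (('v, 'g, 'k) tensor \<Rightarrow> ('v, 'g, 'k) tensor) \<Rightarrow> bool"
  where "module_iso B act X Y f \<longleftrightarrow>
    vs_iso tscale X tscale Y f \<and>
    (\<forall>b\<in>B. act b ` X \<subseteq> X \<and> act b ` Y \<subseteq> Y \<and> (\<forall>x\<in>X. f (act b x) = act b (f x)))"

end

theory Submission
  imports Defs
begin

text \<open>
  Write \<open>A = F\<^sub>q(G)\<close>, \<open>C = F\<^sub>q(K)\<close>, \<open>B = B\<^sub>K\<close>, let \<open>\<psi>\<close> be the convolution inverse of the left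
  section \<open>\<phi>\<close> and use Sweedler's notation for coproducts and coactions.

  Everything rests on one kind of map. A bilinear map \<open>c : C \<times> A \<rightarrow> A\<close> defines an endomorphism
  \<open>v \<otimes> f \<mapsto> v\<^sub>0 \<otimes> c(v\<^sub>1, f)\<close> of \<open>V \<otimes> A\<close> (\<open>twist\<close>). If \<open>c\<close> and \<open>d\<close> are convolution inverse families
  of operators, their twists are inverse to each other. The defining equation of \<open>H\<^sub>R\<close> trades the
  coaction on \<open>v\<close> for \<open>L\<close> on \<open>f\<close>; so the twist by \<open>d\<close> maps \<open>H\<^sub>R\<close> into \<open>V \<otimes> B\<close> if
  \<open>d(\<pi> f\<^sub>1, f\<^sub>2) \<in> B\<close> for all \<open>f\<close>, and the twist by \<open>c\<close> maps \<open>V \<otimes> B\<close> back into \<open>H\<^sub>R\<close> if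
  \<open>L c(k, b) = k\<^sub>1 \<otimes> c(k\<^sub>2, b)\<close> for \<open>b \<in> B\<close>. This is \<open>twist_iso\<close>; if moreover \<open>c\<close> and \<open>d\<close> commute with
  an action of \<open>B\<close>, the isomorphism is one of \<open>B\<close>-modules (\<open>twist_module_iso\<close>).

  For the right module structure take \<open>c(k, f) = \<phi>(k) f\<close> and \<open>d(k, f) = \<psi>(k) f\<close>. The condition on
  \<open>c\<close> is colinearity of \<open>\<phi>\<close>. The condition on \<open>d\<close> follows from \<open>L \<psi>(k) = S k\<^sub>2 \<otimes> \<psi> k\<^sub>1\<close>
  (\<open>inverse_colinear\<close>), which holds because both sides are convolution inverse to \<open>L \<circ> \<phi>\<close>.

  For the left module structure the factor from \<open>C\<close> has to multiply from the right, which reverses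
  the order of convolution, and an inverse \<open>R\<close> of the antipode of \<open>C\<close> is needed: take
  \<open>c(k, f) = f \<psi>(R k)\<close> and \<open>d(k, f) = f \<phi>(R k)\<close>. Let \<open>T\<close> be the inverse antipode of \<open>A\<close>.
  That \<open>T\<close> preserves the kernel of \<open>\<pi>\<close>, and so induces \<open>R\<close>, is not clear for a general quotient, but
  it follows from the section. In the factorisation \<open>f = \<phi>(\<pi> f\<^sub>1) (\<psi>(\<pi> f\<^sub>2) f\<^sub>3)\<close> the second factor lies
  in \<open>B\<close>, where \<open>\<pi> \<circ> T\<close> is the counit. Hence \<open>\<pi> (T f)\<close> depends on \<open>\<pi> f\<close> only, that is,
  \<open>\<pi> \<circ> T = R \<circ> \<pi>\<close> (\<open>SK_inv_proj\<close>), and \<open>R\<close> inherits the properties of \<open>T\<close>.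

  Part (i) is the case of the regular corepresentation \<open>V = C\<close>, \<open>\<rho>\<^sub>R = \<Delta>\<^sub>K\<close>: there \<open>L\<close> itself is an
  isomorphism from \<open>A\<close> onto \<open>H\<^sub>R\<close>, with inverse \<open>\<epsilon> \<otimes> id\<close> (\<open>left_coaction_iso\<close>).
\<close>

section \<open>Multilinear expressions\<close>

text \<open>
  In a multilinear expression each variable occurs once. Linearity in this variable is proved by
  peeling off the operations around it, so one introduction rule for each operation is enough. The
  collections named \<open>multilinear\<close> below extend the following rules to the operations at hand.
\<close>

lemma vector_space_mult: "vector_space ((*) :: 'k::field \<Rightarrow> 'k \<Rightarrow> 'k)"
  by unfold_locales (auto simp: algebra_simps)

lemma bilinear_mapI:
  assumes "\<And>w. Vector_Spaces.linear s1 s3 (\<lambda>u. h u w)" "\<And>u. Vector_Spaces.linear s2 s3 (\<lambda>w. h u w)"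
  shows "bilinear_map s1 s2 s3 h"
  using assms unfolding bilinear_map_def by simp

lemma linear_var: "vector_space s \<Longrightarrow> Vector_Spaces.linear s s (\<lambda>x. x)"
  by (simp add: Vector_Spaces.linear_iff)

lemma linear_comp:
  "Vector_Spaces.linear t r g \<Longrightarrow> Vector_Spaces.linear s t f \<Longrightarrow> Vector_Spaces.linear s r (\<lambda>x. g (f x))"
  by (simp add: Vector_Spaces.linear_iff)

lemma linear_bilinear_left:
  "bilinear_map s1 s2 s3 h \<Longrightarrow> Vector_Spaces.linear s s1 f \<Longrightarrow> Vector_Spaces.linear s s3 (\<lambda>x. h (f x) c)"
  unfolding bilinear_map_def by (auto simp: Vector_Spaces.linear_iff)

lemma linear_bilinear_right:
  "bilinear_map s1 s2 s3 h \<Longrightarrow> Vector_Spaces.linear s s2 f \<Longrightarrow> Vector_Spaces.linear s s3 (\<lambda>x. h c (f x))"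
  unfolding bilinear_map_def by (auto simp: Vector_Spaces.linear_iff)

lemma bilinear_scale: "vector_space s \<Longrightarrow> bilinear_map (*) s s s"
  unfolding bilinear_map_def Vector_Spaces.linear_iff
  using vector_space.vector_space_assms[of s] vector_space_mult
  by (auto simp: mult.commute)

lemma linear_vector_space:
  "Vector_Spaces.linear s t f \<Longrightarrow> vector_space s" "Vector_Spaces.linear s t f \<Longrightarrow> vector_space t"
  by (simp_all add: Vector_Spaces.linear_iff)

lemmas linear_add = Vector_Spaces.linear_iff[THEN iffD1, THEN conjunct2, THEN conjunct2, THEN conjunct1, rule_format]
lemmas linear_scale = Vector_Spaces.linear_iff[THEN iffD1, THEN conjunct2, THEN conjunct2, THEN conjunct2, rule_format]


section \<open>Sums over a representation of a tensor\<close>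

text \<open>
  A tensor is represented by an arbitrary but fixed list of pairs, and \<open>tensor_sum\<close> sums \<open>h\<close> over this
  list. For bilinear \<open>h\<close> this is the value of the linear map induced by \<open>h\<close> on the tensor product. For
  every other \<open>h\<close> the value depends on the list, but it is still additive in \<open>h\<close>, and it still commutes with linear maps
  and with other such sums, so that these rules can be used without conditions on \<open>h\<close>.
\<close>

definition tensor_rep ::
  "('k::field \<Rightarrow> 'a::ab_group_add \<Rightarrow> 'a) \<Rightarrow> ('k \<Rightarrow> 'b::ab_group_add \<Rightarrow> 'b) \<Rightarrow>
   ('a, 'b, 'k) tensor \<Rightarrow> ('a \<times> 'b) list"
  where "tensor_rep s1 s2 t = (SOME xs. t = (\<Sum>(u, w)\<leftarrow>xs. tensor s1 s2 u w))"

definition tensor_sum ::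
  "('k::field \<Rightarrow> 'a::ab_group_add \<Rightarrow> 'a) \<Rightarrow> ('k \<Rightarrow> 'b::ab_group_add \<Rightarrow> 'b) \<Rightarrow>
   ('a \<Rightarrow> 'b \<Rightarrow> 'c::ab_group_add) \<Rightarrow> ('a, 'b, 'k) tensor \<Rightarrow> 'c"
  where "tensor_sum s1 s2 h t = (\<Sum>(u, w)\<leftarrow>tensor_rep s1 s2 t. h u w)"

lemma tensor_rep:
  assumes "vector_space s1" "vector_space s2" "t \<in> tensor_space s1 s2 UNIV UNIV"
  shows "t = (\<Sum>(u, w)\<leftarrow>tensor_rep s1 s2 t. tensor s1 s2 u w)"
proof -
  interpret s1: vector_space s1 by fact
  have "\<exists>xs. t = (\<Sum>(u, w)\<leftarrow>xs. tensor s1 s2 u w)"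
    using tensor_space_sum_list[OF assms s1.subspace_UNIV] by blast
  then show ?thesis unfolding tensor_rep_def by (rule someI_ex)
qed

lemma tensor_sum_tensor:
  assumes "vector_space s1" "vector_space s2" "t \<in> tensor_space s1 s2 UNIV UNIV"
  shows "tensor_sum s1 s2 (tensor s1 s2) t = t"
  using tensor_rep[OF assms] unfolding tensor_sum_def by simp

lemma bilinear_vector_space:
  assumes "bilinear_map s1 s2 s3 h"
  shows "vector_space s1" "vector_space s2" "vector_space s3"
  using assms unfolding bilinear_map_def Vector_Spaces.linear_iff by auto

lemma tensor_lift_eq_tensor_sum:
  assumes h: "bilinear_map s1 s2 s3 h" and t: "t \<in> tensor_space s1 s2 UNIV UNIV"
  shows "tensor_lift s1 s2 h t = tensor_sum s1 s2 h t"
proof -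
  note v = bilinear_vector_space[OF h]
  show ?thesis unfolding tensor_sum_def
    by (subst tensor_rep[OF v(1,2) t]) (rule tensor_lift_sum_list[OF h])
qed

lemma tensor_in_space: "u \<in> U \<Longrightarrow> w \<in> W \<Longrightarrow> tensor s1 s2 u w \<in> tensor_space s1 s2 U W"
  unfolding tensor_space_def by (rule tensor.span_base) blast

lemma sum_list_in_space:
  assumes "\<And>u w. (u, w) \<in> set xs \<Longrightarrow> h u w \<in> tensor_space s1 s2 U W"
  shows "(\<Sum>(u, w)\<leftarrow>xs. h u w) \<in> tensor_space s1 s2 U W"
  using assms unfolding tensor_space_def
  by (induction xs) (auto intro: tensor.span_zero tensor.span_add)

lemma tensor_sum_in_space:
  assumes "\<And>u w. h u w \<in> tensor_space s3 s4 U W"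
  shows "tensor_sum s1 s2 h t \<in> tensor_space s3 s4 U W"
  unfolding tensor_sum_def by (rule sum_list_in_space[OF assms])

lemma tensor_sum_of_tensor:
  assumes "bilinear_map s1 s2 s3 h"
  shows "tensor_sum s1 s2 h (tensor s1 s2 u w) = h u w"
  using tensor_lift_eq_tensor_sum[OF assms tensor_in_space[OF UNIV_I UNIV_I]]
    tensor_lift_tensor[OF assms] by metis

lemma tensor_sum_linear_on:
  assumes "bilinear_map s1 s2 s3 h"
  shows "linear_on (tensor_space s1 s2 UNIV UNIV) tscale s3 (tensor_sum s1 s2 h)"
proof -
  let ?X = "tensor_space s1 s2 UNIV UNIV"
  have X: "x + y \<in> ?X" "tscale c x \<in> ?X" if "x \<in> ?X" "y \<in> ?X" for x y c
    using that unfolding tensor_space_def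
    by (blast intro: tensor.span_add, blast intro: tensor.span_scale)
  note l = tensor_lift_linear[OF assms, unfolded linear_on_def]
  show ?thesis unfolding linear_on_def
  proof (intro conjI ballI allI)
    fix x y c assume "x \<in> ?X" "y \<in> ?X"
    with X[OF this] l[THEN conjunct1, rule_format, OF this]
    show "tensor_sum s1 s2 h (x + y) = tensor_sum s1 s2 h x + tensor_sum s1 s2 h y"
      by (simp only: tensor_lift_eq_tensor_sum[OF assms])
  next
    fix x c assume "x \<in> ?X"
    with X[OF this this] l[THEN conjunct2, rule_format, OF this]
    show "tensor_sum s1 s2 h (tscale c x) = s3 c (tensor_sum s1 s2 h x)"
      by (simp only: tensor_lift_eq_tensor_sum[OF assms])
  qed
qed

lemma linear_on_sum_list:
  assumes f: "linear_on (tensor_space s1 s2 U W) tscale s f" and s: "vector_space s"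
    and h: "\<And>u w. h u w \<in> tensor_space s1 s2 U W"
  shows "f (\<Sum>(u, w)\<leftarrow>xs. h u w) = (\<Sum>(u, w)\<leftarrow>xs. f (h u w))"
proof (induction xs)
  case Nil
  interpret s: vector_space s by fact
  have "0 \<in> tensor_space s1 s2 U W" unfolding tensor_space_def by (rule tensor.span_zero)
  then have "f (tscale 0 0) = s 0 (f 0)" using f unfolding linear_on_def by blast
  then have "f 0 = 0" by (simp only: tensor.scale_zero_right s.scale_zero_left)
  then show ?case by (simp only: list.map sum_list.Nil)
next
  case (Cons p xs)
  have "(\<Sum>(u, w)\<leftarrow>xs. h u w) \<in> tensor_space s1 s2 U W" by (rule sum_list_in_space[OF h])
  then show ?case
    using f[unfolded linear_on_def, THEN conjunct1, rule_format, OF h, of _ "fst p" "snd p"] Cons.IH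
    by (simp only: list.map sum_list.Cons case_prod_unfold)
qed

lemma linear_on_tensor_sum:
  assumes "linear_on (tensor_space s3 s4 U W) tscale s f" "vector_space s"
    and "\<And>u w. h u w \<in> tensor_space s3 s4 U W"
  shows "f (tensor_sum s1 s2 h t) = tensor_sum s1 s2 (\<lambda>u w. f (h u w)) t"
  unfolding tensor_sum_def by (rule linear_on_sum_list[OF assms])

lemma linear_tensor_sum:
  assumes "Vector_Spaces.linear s3 s f"
  shows "f (tensor_sum s1 s2 h t) = tensor_sum s1 s2 (\<lambda>u w. f (h u w)) t"
  unfolding tensor_sum_def by (rule linear_sum_list[OF assms])

lemma tensor_sum_add:
  "tensor_sum s1 s2 (\<lambda>u w. h u w + h' u w) t = tensor_sum s1 s2 h t + tensor_sum s1 s2 h' t"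
  unfolding tensor_sum_def by (simp add: case_prod_unfold sum_list_addf)

lemma linear_tensor_sum_parameter:
  assumes "\<And>u w. Vector_Spaces.linear s t (\<lambda>x. h x u w)"
  shows "Vector_Spaces.linear s t (\<lambda>x. tensor_sum s1 s2 (h x) b)"
proof -
  note v = linear_vector_space[OF assms]
  have "tensor_sum s1 s2 (h (s c x)) b = t c (tensor_sum s1 s2 (h x) b)" for c x
  proof -
    interpret t: vector_space t by (rule v(2))
    show ?thesis
      unfolding linear_scale[OF assms] tensor_sum_def
      by (induction "tensor_rep s1 s2 b") (auto simp: t.linear_scale_self linear_sum_list[OF t.linear_scale_self])
  qed
  moreover have "tensor_sum s1 s2 (h (x + y)) b = tensor_sum s1 s2 (h x) b + tensor_sum s1 s2 (h y) b" for x y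
    unfolding linear_add[OF assms] by (rule tensor_sum_add)
  ultimately show ?thesis using v by (simp add: Vector_Spaces.linear_iff)
qed

lemma tensor_sum_swap:
  fixes h :: "'a::ab_group_add \<Rightarrow> 'b::ab_group_add \<Rightarrow> 'c::ab_group_add \<Rightarrow> 'd::ab_group_add \<Rightarrow> 'e::ab_group_add"
  shows "tensor_sum s1 s2 (\<lambda>x y. tensor_sum s3 s4 (h x y) b) a
    = tensor_sum s3 s4 (\<lambda>u w. tensor_sum s1 s2 (\<lambda>x y. h x y u w) a) b"
proof -
  have "(\<Sum>p\<leftarrow>xs. \<Sum>q\<leftarrow>ys. f p q) = (\<Sum>q\<leftarrow>ys. \<Sum>p\<leftarrow>xs. f p q)"
    for xs :: "('a \<times> 'b) list" and ys :: "('c \<times> 'd) list" and f :: "_ \<Rightarrow> _ \<Rightarrow> 'e"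
    by (induction xs) (simp_all add: sum_list_addf)
  then show ?thesis unfolding tensor_sum_def case_prod_unfold by simp
qed

text \<open>
  A linear map on the type of tensors is also defined on the functionals that are not tensors.
  Composing with a linear projection onto the tensor product makes the extension linear there.
\<close>

lemma trilinear_extends:
  fixes t :: "'a::ab_group_add \<Rightarrow> 'b::ab_group_add \<Rightarrow> 'c::ab_group_add \<Rightarrow> 'd::ab_group_add"
    and s4 :: "'k::field \<Rightarrow> 'd \<Rightarrow> 'd"
  assumes t1: "\<And>y z. Vector_Spaces.linear s1 s4 (\<lambda>x. t x y z)"
    and t2: "\<And>x. bilinear_map s2 s3 s4 (t x)"
  obtains g where "bilinear_map s1 tscale s4 g" "\<And>x y z. g x (tensor s2 s3 y z) = t x y z"
proof -
  let ?X = "tensor_space s2 s3 UNIV UNIV :: ('b, 'c, 'k) tensor set"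
  interpret P: vector_space_pair "tscale :: 'k \<Rightarrow> ('b, 'c, 'k) tensor \<Rightarrow> _" tscale ..
  have "tensor.subspace ?X" unfolding tensor_space_def by (rule tensor.subspace_span)
  then obtain p where p: "range p \<subseteq> ?X" "Vector_Spaces.linear tscale tscale p" "\<And>x. x \<in> ?X \<Longrightarrow> p x = x"
    using P.linear_exists_right_inverse_on[OF tensor.linear_id, of ?X]
    unfolding id_apply image_id by metis
  have pX: "p x \<in> ?X" for x using p(1) by auto
  show thesis
  proof
    show "bilinear_map s1 tscale s4 (\<lambda>x w. tensor_sum s2 s3 (t x) (p w))"
    proof (rule bilinear_mapI)
      show "Vector_Spaces.linear s1 s4 (\<lambda>x. tensor_sum s2 s3 (t x) (p w))" for w
        by (rule linear_tensor_sum_parameter[OF t1])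
      show "Vector_Spaces.linear tscale s4 (\<lambda>w. tensor_sum s2 s3 (t x) (p w))" for x
      proof -
        note l = tensor_sum_linear_on[OF t2[of x], unfolded linear_on_def]
        show ?thesis unfolding Vector_Spaces.linear_iff linear_add[OF p(2)] linear_scale[OF p(2)]
          by (intro conjI allI vector_space_tscale bilinear_vector_space(3)[OF t2]
              l[THEN conjunct1, rule_format, OF pX pX] l[THEN conjunct2, rule_format, OF pX])
      qed
    qed
    show "tensor_sum s2 s3 (t x) (p (tensor s2 s3 y z)) = t x y z" for x y z
      by (simp only: p(3)[OF tensor_in_space[OF UNIV_I UNIV_I]] tensor_sum_of_tensor[OF t2])
  qed
qed

lemma bilinear_linear_comp:
  assumes "bilinear_map s1 s2 s3 h" "Vector_Spaces.linear s s1 f" "Vector_Spaces.linear s' s2 g"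
  shows "bilinear_map s s' s3 (\<lambda>x y. h (f x) (g y))"
  by (intro bilinear_mapI linear_bilinear_left[OF assms(1)] linear_bilinear_right[OF assms(1)] assms)

lemma tensor_map_eq_tensor_sum:
  assumes "Vector_Spaces.linear s1 s3 f" "Vector_Spaces.linear s2 s4 g"
    and t: "t \<in> tensor_space s1 s2 UNIV UNIV"
  shows "tensor_map s1 s2 s3 s4 f g t = tensor_sum s1 s2 (\<lambda>u w. tensor s3 s4 (f u) (g w)) t"
  unfolding tensor_map_def
  by (rule tensor_lift_eq_tensor_sum[OF bilinear_linear_comp[OF bilinear_map_tensor assms(1,2)] t])
    (rule linear_vector_space(2)[OF assms(1)] linear_vector_space(2)[OF assms(2)])+

lemma linear_tensor_sum_argument:
  assumes h: "bilinear_map s1 s2 s3 h" and f: "Vector_Spaces.linear s tscale f"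
    and X: "\<And>x. f x \<in> tensor_space s1 s2 UNIV UNIV"
  shows "Vector_Spaces.linear s s3 (\<lambda>x. tensor_sum s1 s2 h (f x))"
proof -
  note l = tensor_sum_linear_on[OF h, unfolded linear_on_def]
  show ?thesis unfolding Vector_Spaces.linear_iff linear_add[OF f] linear_scale[OF f]
    by (intro conjI allI linear_vector_space(1)[OF f] bilinear_vector_space(3)[OF h]
        l[THEN conjunct1, rule_format, OF X X] l[THEN conjunct2, rule_format, OF X])
qed

lemma tensor_map_assoc_eq_tensor_sum:
  assumes f: "Vector_Spaces.linear s1 tscale f" and X: "\<And>u. f u \<in> tensor_space s3 s4 UNIV UNIV"
    and v: "vector_space s2" "vector_space s3" "vector_space s4"
    and t: "t \<in> tensor_space s1 s2 UNIV UNIV"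
  shows "tensor_map_assoc s1 s2 s3 s4 f t =
    tensor_sum s1 s2 (\<lambda>u w. tensor_sum s3 s4 (\<lambda>x y. tensor s3 tscale x (tensor s4 s2 y w)) (f u)) t"
proof -
  note b1 = bilinear_map_tensor[OF v(2) vector_space_tscale]
  note b2 = bilinear_map_tensor[OF v(3,1)]
  have b: "bilinear_map s3 s4 tscale (\<lambda>x y. tensor s3 tscale x (tensor s4 s2 y w))" for w
    by (intro bilinear_mapI linear_bilinear_left[OF b1] linear_bilinear_right[OF b1]
        linear_bilinear_left[OF b2] linear_var v)
  have *: "tensor_map_assoc s1 s2 s3 s4 f t =
    tensor_lift s1 s2 (\<lambda>u w. tensor_sum s3 s4 (\<lambda>x y. tensor s3 tscale x (tensor s4 s2 y w)) (f u)) t"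
    unfolding tensor_map_assoc_def tensor_lift_eq_tensor_sum[OF b X] ..
  show ?thesis unfolding *
    by (intro tensor_lift_eq_tensor_sum[where ?s3.0 = tscale, OF _ t] bilinear_mapI linear_tensor_sum_argument[OF b f X]
        linear_tensor_sum_parameter linear_bilinear_right[OF b1] linear_bilinear_right[OF b2] linear_var v)
qed

lemma trilinear_factors_through_tensor:
  assumes t1: "\<And>y z. Vector_Spaces.linear s1 s4 (\<lambda>x. t x y z)"
    and t2: "\<And>x. bilinear_map s2 s3 s4 (t x)"
  obtains g where "linear_on (tensor_space s1 tscale UNIV UNIV) tscale s4 g"
    "\<And>x y z. g (tensor s1 tscale x (tensor s2 s3 y z)) = t x y z"
proof -
  obtain g where g: "bilinear_map s1 tscale s4 g" "\<And>x y z. g x (tensor s2 s3 y z) = t x y z"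
    using trilinear_extends[OF t1 t2] by blast
  show thesis
    by (rule that[OF tensor_sum_linear_on[OF g(1)]]) (simp only: tensor_sum_of_tensor[OF g(1)] g(2))
qed

text \<open>
  Equations in \<open>X \<otimes> (Y \<otimes> Z)\<close>, such as the two axioms of coassociativity and the equation that defines
  the induced space, are used in this form: the tensors may be replaced by any trilinear map.
\<close>

lemma trilinear_eq:
  assumes t1: "\<And>y z. Vector_Spaces.linear s1 s4 (\<lambda>x. t x y z)"
    and t2: "\<And>x. bilinear_map s2 s3 s4 (t x)"
    and eq: "tensor_sum p1 p2 (\<lambda>u w. tensor_sum p3 p4
        (\<lambda>x y. tensor s1 tscale (a1 u w x y) (tensor s2 s3 (a2 u w x y) (a3 u w x y))) (f u w)) T
      = tensor_sum q1 q2 (\<lambda>u w. tensor_sum q3 q4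
        (\<lambda>x y. tensor s1 tscale (b1 u w x y) (tensor s2 s3 (b2 u w x y) (b3 u w x y))) (g u w)) T'"
  shows "tensor_sum p1 p2 (\<lambda>u w. tensor_sum p3 p4
        (\<lambda>x y. t (a1 u w x y) (a2 u w x y) (a3 u w x y)) (f u w)) T
      = tensor_sum q1 q2 (\<lambda>u w. tensor_sum q3 q4
        (\<lambda>x y. t (b1 u w x y) (b2 u w x y) (b3 u w x y)) (g u w)) T'"
proof -
  obtain G where G: "linear_on (tensor_space s1 tscale UNIV UNIV) tscale s4 G"
    "\<And>x y z. G (tensor s1 tscale x (tensor s2 s3 y z)) = t x y z"
    using trilinear_factors_through_tensor[OF t1 t2] by blast
  note comm = linear_on_tensor_sum[OF G(1) linear_vector_space(2)[OF t1]]
  have "G (tensor_sum q1 q2 (\<lambda>u w. tensor_sum q3 q4 (\<lambda>x y. tensor s1 tscale (b1 u w x y) (tensor s2 s3 (b2 u w x y) (b3 u w x y))) (g u w)) T')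
     = tensor_sum q1 q2 (\<lambda>u w. tensor_sum q3 q4 (\<lambda>x y. t (b1 u w x y) (b2 u w x y) (b3 u w x y)) (g u w)) T'"
    by (simp only: comm tensor_sum_in_space tensor_in_space UNIV_I G(2))
  moreover have "G (tensor_sum p1 p2 (\<lambda>u w. tensor_sum p3 p4 (\<lambda>x y. tensor s1 tscale (a1 u w x y) (tensor s2 s3 (a2 u w x y) (a3 u w x y))) (f u w)) T)
     = tensor_sum p1 p2 (\<lambda>u w. tensor_sum p3 p4 (\<lambda>x y. t (a1 u w x y) (a2 u w x y) (a3 u w x y)) (f u w)) T"
    by (simp only: comm tensor_sum_in_space tensor_in_space UNIV_I G(2))
  ultimately show ?thesis using eq by simp
qed

lemma tensor_sum_collapse:
  assumes h: "bilinear_map s1 s2 s h"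
  shows "tensor_sum s1 s2 h (tensor_sum p q (\<lambda>u w. tensor s1 s2 (f u w) (g u w)) T)
    = tensor_sum p q (\<lambda>u w. h (f u w) (g u w)) T"
  by (simp only: linear_on_tensor_sum[OF tensor_sum_linear_on[OF h] bilinear_vector_space(3)[OF h]]
      tensor_in_space UNIV_I tensor_sum_of_tensor[OF h])

lemma linear_on_comp:
  assumes "linear_on X s t f" "linear_on Y t u g" "\<And>x. x \<in> X \<Longrightarrow> f x \<in> Y"
  shows "linear_on X s u (\<lambda>x. g (f x))"
  using assms unfolding linear_on_def by simp

lemma linear_on_subset: "linear_on Y s t f \<Longrightarrow> X \<subseteq> Y \<Longrightarrow> linear_on X s t f"
  unfolding linear_on_def by blast

lemma linear_on_ident: "linear_on X s s (\<lambda>x. x)"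
  unfolding linear_on_def by simp


section \<open>Sweedler sums\<close>

text \<open>
  \<open>coact_sum h v\<close> is \<open>\<Sum> h(v\<^sub>0, v\<^sub>1)\<close>, and \<open>sweedler h a\<close> is \<open>\<Sum> h(a\<^sub>1, a\<^sub>2)\<close> in Sweedler's notation.
\<close>

definition (in right_corepresentation) coact_sum :: "('v \<Rightarrow> 'c \<Rightarrow> 'w::ab_group_add) \<Rightarrow> 'v \<Rightarrow> 'w"
  where "coact_sum h v = tensor_sum sV sC h (\<rho> v)"

definition (in coalgebra) sweedler :: "('a \<Rightarrow> 'a \<Rightarrow> 'w::ab_group_add) \<Rightarrow> 'a \<Rightarrow> 'w"
  where "sweedler h a = tensor_sum scale scale h (comult a)"

context right_corepresentation
begin

lemma coact_sum_cong: "(\<And>w c. h w c = h' w c) \<Longrightarrow> coact_sum h v = coact_sum h' v"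
  by (rule arg_cong[where f = "\<lambda>h. coact_sum h v"]) (intro ext)

lemma linear_coact_sum: "Vector_Spaces.linear s t f \<Longrightarrow> f (coact_sum h v) = coact_sum (\<lambda>x y. f (h x y)) v"
  unfolding coact_sum_def by (rule linear_tensor_sum)

lemma linear_coact_sum_parameter:
  "(\<And>u w. Vector_Spaces.linear s t (\<lambda>x. h x u w)) \<Longrightarrow> Vector_Spaces.linear s t (\<lambda>x. coact_sum (h x) v)"
  unfolding coact_sum_def by (rule linear_tensor_sum_parameter)

lemma linear_coact_sum_argument:
  "Vector_Spaces.linear s sV f \<Longrightarrow> bilinear_map sV sC t h \<Longrightarrow> Vector_Spaces.linear s t (\<lambda>x. coact_sum h (f x))"
  unfolding coact_sum_def
  by (rule linear_tensor_sum_argument[OF _ linear_comp[OF coact_linear] coact_in])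

lemma coact_sum_counit:
  assumes g: "Vector_Spaces.linear sV t g"
  shows "coact_sum (\<lambda>w c. t (\<epsilon> c) (g w)) v = g v"
proof -
  have "bilinear_map sV sC sV (\<lambda>w c. sV (\<epsilon> c) w)"
    by (intro bilinear_mapI linear_bilinear_left[OF bilinear_scale]
        linear_bilinear_right[OF bilinear_scale] C.counit_linear linear_var V.vector_space_axioms)
  from coact_counit[unfolded tensor_lift_eq_tensor_sum[OF this coact_in], of v]
  have "g v = g (coact_sum (\<lambda>w c. sV (\<epsilon> c) w) v)" unfolding coact_sum_def by simp
  then show ?thesis unfolding linear_coact_sum[OF g] linear_scale[OF g] ..
qed

lemma coact_sum_coassoc:
  assumes t: "\<And>y z. Vector_Spaces.linear sV s (\<lambda>x. t x y z)" "\<And>x z. Vector_Spaces.linear sC s (\<lambda>y. t x y z)"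
    "\<And>x y. Vector_Spaces.linear sC s (t x y)"
  shows "coact_sum (\<lambda>w c. coact_sum (\<lambda>u d. t u d c) w) v = coact_sum (\<lambda>w c. C.sweedler (t w) c) v"
proof -
  note vC = C.vector_space_axioms and vV = V.vector_space_axioms
  have lid: "Vector_Spaces.linear sV sV id" by (rule V.linear_id)
  note tens = bilinear_map_tensor[OF vV vector_space_tscale]
  have id: "C.sweedler (tensor sC sC) c = \<Delta> c" for c
    unfolding C.sweedler_def by (rule tensor_sum_tensor[OF vC vC C.comult_in])
  have "tensor sV tscale w (\<Delta> c) = tensor_sum sC sC (\<lambda>x y. tensor sV tscale w (tensor sC sC x y)) (\<Delta> c)" for w c
    using linear_tensor_sum[OF linear_bilinear_right[OF tens linear_var[OF vector_space_tscale]], of w sC sC "tensor sC sC" "\<Delta> c"] id[unfolded C.sweedler_def, of c] by simp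
  note r = coact_coassoc[of v, unfolded tensor_map_assoc_eq_tensor_sum[OF coact_linear coact_in vC vV vC coact_in]
      tensor_map_eq_tensor_sum[OF lid C.comult_linear coact_in] id_apply this]
  show ?thesis
    unfolding coact_sum_def C.sweedler_def
    by (rule trilinear_eq[OF t(1) bilinear_mapI[OF t(2,3)] r])
qed

end

context coalgebra
begin

text \<open>
  The coproduct is a coaction of the coalgebra on itself, so the rules for coactions
  specialise to coproducts.
\<close>

lemma regular_corepresentation: "right_corepresentation scale scale comult counit comult"
  using coalgebra_axioms
  by (simp only: right_corepresentation_def right_corepresentation_axioms_def comult_linear comult_in
      coassoc counit_right vector_space_axioms simp_thms)

lemma sweedler_eq_coact_sum: "sweedler h a = right_corepresentation.coact_sum scale scale comult h a"
  unfolding sweedler_def right_corepresentation.coact_sum_def[OF regular_corepresentation] ..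

lemma sweedler_cong: "(\<And>x y. h x y = h' x y) \<Longrightarrow> sweedler h a = sweedler h' a"
  by (rule arg_cong[where f = "\<lambda>h. sweedler h a"]) (intro ext)

lemma linear_sweedler: "Vector_Spaces.linear s t f \<Longrightarrow> f (sweedler h a) = sweedler (\<lambda>x y. f (h x y)) a"
  unfolding sweedler_def by (rule linear_tensor_sum)

lemma linear_sweedler_parameter:
  "(\<And>u w. Vector_Spaces.linear s t (\<lambda>x. h x u w)) \<Longrightarrow> Vector_Spaces.linear s t (\<lambda>x. sweedler (h x) a)"
  unfolding sweedler_def by (rule linear_tensor_sum_parameter)

lemma linear_sweedler_argument:
  "Vector_Spaces.linear s scale f \<Longrightarrow> bilinear_map scale scale t h \<Longrightarrow> Vector_Spaces.linear s t (\<lambda>x. sweedler h (f x))"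
  unfolding sweedler_def
  by (rule linear_tensor_sum_argument[OF _ linear_comp[OF comult_linear] comult_in])

lemma sweedler_swap:
  "sweedler (\<lambda>x y. sweedler (h x y) b) a = sweedler (\<lambda>u w. sweedler (\<lambda>x y. h x y u w) a) b"
  unfolding sweedler_def by (rule tensor_sum_swap)

lemma sweedler_counit_right:
  "Vector_Spaces.linear scale t g \<Longrightarrow> sweedler (\<lambda>x y. t (counit y) (g x)) a = g a"
  unfolding sweedler_eq_coact_sum
  by (rule right_corepresentation.coact_sum_counit[OF regular_corepresentation])

lemma sweedler_counit_left:
  assumes g: "Vector_Spaces.linear scale t g"
  shows "sweedler (\<lambda>x y. t (counit x) (g y)) a = g a"
proof -
  have "bilinear_map scale scale scale (\<lambda>x y. scale (counit x) y)"
    by (intro bilinear_mapI linear_bilinear_left[OF bilinear_scale]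
        linear_bilinear_right[OF bilinear_scale] counit_linear linear_var vector_space_axioms)
  from counit_left[unfolded tensor_lift_eq_tensor_sum[OF this comult_in], of a]
  have "g a = g (sweedler (\<lambda>x y. scale (counit x) y) a)" unfolding sweedler_def by simp
  then show ?thesis unfolding linear_sweedler[OF g] linear_scale[OF g] ..
qed

lemma sweedler_coassoc:
  assumes "\<And>y z. Vector_Spaces.linear scale s (\<lambda>x. t x y z)" "\<And>x z. Vector_Spaces.linear scale s (\<lambda>y. t x y z)"
    "\<And>x y. Vector_Spaces.linear scale s (t x y)"
  shows "sweedler (\<lambda>x y. sweedler (\<lambda>u w. t u w y) x) a = sweedler (\<lambda>x y. sweedler (t x) y) a"
  using right_corepresentation.coact_sum_coassoc[OF regular_corepresentation assms]
  unfolding sweedler_eq_coact_sum .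

text \<open>
  The four components \<open>f\<^sub>1, \<dots>, f\<^sub>4\<close> are regrouped so that \<open>f\<^sub>2\<close> and \<open>f\<^sub>3\<close> form one coproduct. If they
  cancel against each other, as in \<open>S f\<^sub>2 f\<^sub>3 = \<epsilon>\<close>, only the outer two remain.
\<close>

lemma sweedler_cancel_middle:
  assumes t: "\<And>b x y. Vector_Spaces.linear scale s (\<lambda>a. t a b x y)"
    "\<And>a x y. Vector_Spaces.linear scale s (\<lambda>b. t a b x y)"
    "\<And>a b y. Vector_Spaces.linear scale s (\<lambda>x. t a b x y)"
    "\<And>a b x. Vector_Spaces.linear scale s (\<lambda>y. t a b x y)"
    and r: "\<And>a. Vector_Spaces.linear scale s (r a)"
    and tr: "\<And>m a y. sweedler (\<lambda>b x. t a b x y) m = s (counit m) (r a y)"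
  shows "sweedler (\<lambda>u v. sweedler (\<lambda>a b. sweedler (\<lambda>x y. t a b x y) v) u) f = sweedler r f"
proof -
  have "sweedler (\<lambda>u v. sweedler (\<lambda>a b. sweedler (t a b) v) u) f
      = sweedler (\<lambda>a w. sweedler (\<lambda>b v. sweedler (t a b) v) w) f"
    by (rule sweedler_coassoc[where s=s];
        (rule linear_sweedler_parameter linear_sweedler_argument bilinear_mapI
          linear_var[OF vector_space_axioms] t)+)
  also have "\<dots> = sweedler (\<lambda>a w. sweedler (\<lambda>m y. sweedler (\<lambda>b x. t a b x y) m) w) f"
    by (rule sweedler_cong, rule sweedler_coassoc[OF t(2,3,4), symmetric])
  also have "\<dots> = sweedler r f"
    unfolding tr by (rule sweedler_cong, rule sweedler_counit_left[OF r])
  finally show ?thesis .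
qed

end


section \<open>Antipodes\<close>

context hopf_algebra
begin

lemma bilinear_mult: "bilinear_map scale scale scale (*)"
  by (intro bilinear_mapI)
    (simp_all add: Vector_Spaces.linear_iff vector_space_axioms algebra_simps scale_mult_left scale_mult_right)

lemmas multilinear =
  linear_var[OF vector_space_axioms] linear_sweedler_parameter linear_sweedler_argument bilinear_mapI
  linear_bilinear_left[OF bilinear_mult] linear_bilinear_right[OF bilinear_mult]
  linear_comp[OF antipode_linear] linear_comp[OF counit_linear]
  linear_bilinear_left[OF bilinear_scale[OF vector_space_axioms]]
  linear_bilinear_right[OF bilinear_scale[OF vector_space_axioms]]

lemma sweedler_one:
  assumes h: "bilinear_map scale scale s h"
  shows "sweedler h 1 = h 1 1"
  unfolding sweedler_def comult_one by (rule tensor_sum_of_tensor[OF h])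

lemma sweedler_mult:
  assumes h: "bilinear_map scale scale s h"
  shows "sweedler h (x * y) = sweedler (\<lambda>a b. sweedler (\<lambda>c d. h (a * c) (b * d)) y) x"
proof -
  note tens = bilinear_map_tensor[OF vector_space_axioms vector_space_axioms]
  note rules = multilinear linear_bilinear_left[OF tens] linear_bilinear_right[OF tens]
  have 1: "bilinear_map scale scale tscale (\<lambda>c d. tensor scale scale (a * c) (b * d))" for a b
    by (rule rules)+
  have 2: "bilinear_map scale scale tscale (\<lambda>a b. sweedler (\<lambda>c d. tensor scale scale (a * c) (b * d)) y)"
    by (rule rules)+
  have "comult (x * y) = sweedler (\<lambda>a b. sweedler (\<lambda>c d. tensor scale scale (a * c) (b * d)) y) x"
    unfolding comult_mult tensor_mult_def tensor_lift_eq_tensor_sum[OF 1 comult_in]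
    using tensor_lift_eq_tensor_sum[OF 2 comult_in] unfolding sweedler_def .
  then show ?thesis
    unfolding sweedler_def
    by (simp only: linear_on_tensor_sum[OF tensor_sum_linear_on[OF h] bilinear_vector_space(3)[OF h]]
        tensor_in_space UNIV_I tensor_sum_of_tensor[OF h] tensor_sum_in_space)
qed

lemma sweedler_antipode_left:
  assumes g: "Vector_Spaces.linear scale s g"
  shows "sweedler (\<lambda>x y. g (antipode x * y)) a = s (counit a) (g 1)"
proof -
  have "bilinear_map scale scale scale (\<lambda>x y. antipode x * y)" by (rule multilinear)+
  from antipode_left[unfolded tensor_lift_eq_tensor_sum[OF this comult_in], of a]
  have "g (sweedler (\<lambda>x y. antipode x * y) a) = g (scale (counit a) 1)" unfolding sweedler_def by simp
  then show ?thesis unfolding linear_sweedler[OF g] linear_scale[OF g] .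
qed

lemma sweedler_antipode_right:
  assumes g: "Vector_Spaces.linear scale s g"
  shows "sweedler (\<lambda>x y. g (x * antipode y)) a = s (counit a) (g 1)"
proof -
  have "bilinear_map scale scale scale (\<lambda>x y. x * antipode y)" by (rule multilinear)+
  from antipode_right[unfolded tensor_lift_eq_tensor_sum[OF this comult_in], of a]
  have "g (sweedler (\<lambda>x y. x * antipode y) a) = g (scale (counit a) 1)" unfolding sweedler_def by simp
  then show ?thesis unfolding linear_sweedler[OF g] linear_scale[OF g] .
qed

lemma antipode_one: "antipode 1 = 1"
proof -
  have "sweedler (\<lambda>x y. antipode x * y) 1 = antipode 1 * 1"
    by (rule sweedler_one) (rule multilinear)+
  moreover have "sweedler (\<lambda>x y. antipode x * y) 1 = scale (counit 1) 1"
    by (rule sweedler_antipode_left) (rule multilinear)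
  ultimately show ?thesis by (simp add: counit_one)
qed

lemma counit_antipode: "counit (antipode a) = counit a"
proof -
  have "counit (antipode a) = sweedler (\<lambda>x y. counit y * counit (antipode x)) a"
    by (rule sweedler_counit_right[symmetric]) (rule multilinear linear_comp[OF counit_linear])+
  also have "\<dots> = sweedler (\<lambda>x y. counit (antipode x * y)) a" by (simp add: counit_mult mult.commute)
  also have "\<dots> = counit a * counit 1" by (rule sweedler_antipode_left) (rule counit_linear)
  finally show ?thesis by (simp add: counit_one)
qed

text \<open>
  \<open>S y S x = S y\<^sub>1 S x\<^sub>1 (x\<^sub>2 y\<^sub>2) S(x\<^sub>3 y\<^sub>3) = S(x y)\<close>: the product \<open>(x\<^sub>2 y\<^sub>2) S(x\<^sub>3 y\<^sub>3)\<close> can be inserted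
  by the antipode law for \<open>x y\<close>, and \<open>S y\<^sub>1 (S x\<^sub>1 x\<^sub>2) y\<^sub>2\<close> then collapses from the inside.
\<close>

lemma antipode_mult: "antipode (x * y) = antipode y * antipode x"
proof -
  \<comment> \<open>the antipode law for the product \<open>w z\<close>, with a factor in front\<close>
  have d: "sweedler (\<lambda>a b. sweedler (\<lambda>c d. antipode y' * antipode x' * (a * c) * antipode (b * d)) z) w
      = scale (counit w) (scale (counit z) (antipode y' * antipode x'))" for x' y' z w
  proof -
    have "sweedler (\<lambda>a b. sweedler (\<lambda>c d. antipode y' * antipode x' * (a * c) * antipode (b * d)) z) w
      = sweedler (\<lambda>a b. antipode y' * antipode x' * a * antipode b) (w * z)"
      by (rule sweedler_mult[symmetric]) (rule multilinear)+
    also have "\<dots> = sweedler (\<lambda>a b. antipode y' * antipode x' * (a * antipode b)) (w * z)"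
      by (simp only: mult.assoc)
    also have "\<dots> = scale (counit (w * z)) (antipode y' * antipode x' * 1)"
      by (rule sweedler_antipode_right) (rule multilinear)+
    finally show ?thesis by (simp add: counit_mult)
  qed
  \<comment> \<open>\<open>X S y\<^sub>1 y\<^sub>2 Y(y\<^sub>3) = X Y(y)\<close>, needed once for \<open>x\<close> and once for \<open>y\<close>\<close>
  have e: "sweedler (\<lambda>b d. sweedler (\<lambda>y' z. X * antipode y' * z * Y d) b) y = X * Y y"
    if Y: "Vector_Spaces.linear scale scale Y" for X Y y
  proof -
    have "sweedler (\<lambda>y' z. X * antipode y' * z * Y d) b = scale (counit b) (X * Y d)" for b d
      using sweedler_antipode_left[of scale "\<lambda>u. X * u * Y d" b]
      by (simp add: multilinear mult.assoc)
    then show ?thesis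
      using sweedler_counit_left[of scale "\<lambda>d. X * Y d" y] by (simp add: multilinear linear_comp[OF Y])
  qed
  have "antipode y * antipode x = sweedler (\<lambda>x' w. sweedler (\<lambda>y' z.
      scale (counit w) (scale (counit z) (antipode y' * antipode x'))) y) x"
  proof -
    have "sweedler (\<lambda>y' z. scale (counit w) (scale (counit z) (antipode y' * antipode x'))) y
      = scale (counit w) (antipode y * antipode x')" for w x'
    proof -
      have "sweedler (\<lambda>y' z. scale (counit z) (scale (counit w) (antipode y' * antipode x'))) y
       = scale (counit w) (antipode y * antipode x')"
        by (rule sweedler_counit_right) (rule multilinear)+
      then show ?thesis by (simp add: mult.commute)
    qed
    then show ?thesis
      using sweedler_counit_right[of scale "\<lambda>x'. antipode y * antipode x'" x] by (simp add: multilinear)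
  qed
  also have "\<dots> = sweedler (\<lambda>x' w. sweedler (\<lambda>y' z. sweedler (\<lambda>a b. sweedler (\<lambda>c d.
      antipode y' * antipode x' * (a * c) * antipode (b * d)) z) w) y) x"
    by (simp only: d)
  also have "\<dots> = sweedler (\<lambda>y' z. sweedler (\<lambda>x' w. sweedler (\<lambda>a b. sweedler (\<lambda>c d.
      antipode y' * antipode x' * (a * c) * antipode (b * d)) z) w) x) y"
    by (rule sweedler_swap)
  also have "\<dots> = sweedler (\<lambda>y' z. sweedler (\<lambda>m b. sweedler (\<lambda>x' a. sweedler (\<lambda>c d.
      antipode y' * antipode x' * (a * c) * antipode (b * d)) z) m) x) y"
    by (rule sweedler_cong, rule sweedler_coassoc[symmetric, where s=scale]; (rule multilinear)+)
  also have "\<dots> = sweedler (\<lambda>y' z. sweedler (\<lambda>c d. antipode y' * c * antipode (x * d)) z) y"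
  proof (rule sweedler_cong)
    fix y' z
    have "sweedler (\<lambda>m b. sweedler (\<lambda>x' a. sweedler (\<lambda>c d.
        antipode y' * antipode x' * (a * c) * antipode (b * d)) z) m) x
      = sweedler (\<lambda>c d. sweedler (\<lambda>m b. sweedler (\<lambda>x' a.
        antipode y' * antipode x' * a * (c * antipode (b * d))) m) x) z"
      by (simp only: sweedler_swap[where b=z] mult.assoc)
    also have "\<dots> = sweedler (\<lambda>c d. antipode y' * (c * antipode (x * d))) z"
      by (rule sweedler_cong, rule e) (rule multilinear)+
    finally show "sweedler (\<lambda>m b. sweedler (\<lambda>x' a. sweedler (\<lambda>c d.
        antipode y' * antipode x' * (a * c) * antipode (b * d)) z) m) x
      = sweedler (\<lambda>c d. antipode y' * c * antipode (x * d)) z" by (simp only: mult.assoc)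
  qed
  also have "\<dots> = sweedler (\<lambda>b d. sweedler (\<lambda>y' z. 1 * antipode y' * z * antipode (x * d)) b) y"
    by (subst sweedler_coassoc[where s=scale]; (rule multilinear)?)
      ((rule multilinear)+, simp)
  also have "\<dots> = 1 * antipode (x * y)"
    by (rule e) (rule multilinear)+
  finally show ?thesis by simp
qed

end


section \<open>Sections of a quantum subgroup\<close>

context quantum_subgroup
begin

lemmas multilinear =
  linear_var[OF G.vector_space_axioms] linear_var[OF K.vector_space_axioms]
  G.linear_sweedler_parameter K.linear_sweedler_parameter
  G.linear_sweedler_argument K.linear_sweedler_argument bilinear_mapI
  linear_bilinear_left[OF G.bilinear_mult] linear_bilinear_right[OF G.bilinear_mult]
  linear_bilinear_left[OF K.bilinear_mult] linear_bilinear_right[OF K.bilinear_mult]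
  linear_comp[OF G.antipode_linear] linear_comp[OF G.counit_linear]
  linear_comp[OF K.antipode_linear] linear_comp[OF K.counit_linear] linear_comp[OF proj_linear]
  linear_bilinear_left[OF bilinear_scale[OF G.vector_space_axioms]]
  linear_bilinear_right[OF bilinear_scale[OF G.vector_space_axioms]]
  linear_bilinear_left[OF bilinear_scale[OF K.vector_space_axioms]]
  linear_bilinear_right[OF bilinear_scale[OF K.vector_space_axioms]]
  linear_bilinear_left[OF bilinear_map_tensor[OF K.vector_space_axioms K.vector_space_axioms]]
  linear_bilinear_right[OF bilinear_map_tensor[OF K.vector_space_axioms K.vector_space_axioms]]
  linear_bilinear_left[OF bilinear_map_tensor[OF K.vector_space_axioms G.vector_space_axioms]]
  linear_bilinear_right[OF bilinear_map_tensor[OF K.vector_space_axioms G.vector_space_axioms]]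

lemma sweedler_proj:
  assumes h: "bilinear_map sK sK s h"
  shows "K.sweedler h (\<pi> f) = G.sweedler (\<lambda>x y. h (\<pi> x) (\<pi> y)) f"
  unfolding K.sweedler_def G.sweedler_def proj_comult
    tensor_map_eq_tensor_sum[OF proj_linear proj_linear G.comult_in]
  by (rule tensor_sum_collapse[OF h])

lemma left_coaction_eq: "left_coaction sG \<Delta>G sK \<pi> f = G.sweedler (\<lambda>x y. tensor sK sG (\<pi> x) y) f"
  unfolding left_coaction_def G.sweedler_def tensor_map_eq_tensor_sum[OF proj_linear G.linear_id G.comult_in]
  by simp

lemma coinvariant_iff:
  "f \<in> coinvariants sG \<Delta>G sK \<pi> \<longleftrightarrow> G.sweedler (\<lambda>x y. tensor sK sG (\<pi> x) y) f = tensor sK sG 1 f"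
  unfolding coinvariants_def left_coaction_eq by simp

lemma sweedler_coinvariant:
  assumes f: "f \<in> coinvariants sG \<Delta>G sK \<pi>" and h: "bilinear_map sK sG s h"
  shows "G.sweedler (\<lambda>x y. h (\<pi> x) y) f = h 1 f"
proof -
  have "tensor_sum sK sG h (G.sweedler (\<lambda>x y. tensor sK sG (\<pi> x) y) f) = tensor_sum sK sG h (tensor sK sG 1 f)"
    using f unfolding coinvariant_iff by simp
  then show ?thesis unfolding G.sweedler_def tensor_sum_collapse[OF h] tensor_sum_of_tensor[OF h] .
qed

end

text \<open>
  Colinearity of the section is an equation between tensors here, because an assumption of a locale
  cannot range over bilinear maps into all spaces; \<open>sweedler_section\<close> is the form used in
  computations.
\<close>

locale cleft_quantum_subgroup = quantum_subgroup +
  fixes \<phi> \<psi>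
  assumes section_linear: "Vector_Spaces.linear sK sG \<phi>"
    and inverse_linear: "Vector_Spaces.linear sK sG \<psi>"
    and section_inverse: "K.sweedler (\<lambda>x y. \<phi> x * \<psi> y) k = sG (\<epsilon>K k) 1"
    and inverse_section: "K.sweedler (\<lambda>x y. \<psi> x * \<phi> y) k = sG (\<epsilon>K k) 1"
    and section_colinear: "G.sweedler (\<lambda>x y. tensor sK sG (\<pi> x) y) (\<phi> k) = K.sweedler (\<lambda>x y. tensor sK sG x (\<phi> y)) k"
begin

lemmas cleft_multilinear = multilinear linear_comp[OF section_linear] linear_comp[OF inverse_linear]

lemma sweedler_section:
  assumes h: "bilinear_map sK sG s h"
  shows "G.sweedler (\<lambda>x y. h (\<pi> x) y) (\<phi> k) = K.sweedler (\<lambda>x y. h x (\<phi> y)) k"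
proof -
  have "tensor_sum sK sG h (G.sweedler (\<lambda>x y. tensor sK sG (\<pi> x) y) (\<phi> k))
    = tensor_sum sK sG h (K.sweedler (\<lambda>x y. tensor sK sG x (\<phi> y)) k)"
    unfolding section_colinear ..
  then show ?thesis unfolding G.sweedler_def K.sweedler_def tensor_sum_collapse[OF h] .
qed

lemma sweedler_inverse_section:
  assumes g: "Vector_Spaces.linear sG s g"
  shows "K.sweedler (\<lambda>x y. g (\<psi> x * \<phi> y)) k = s (\<epsilon>K k) (g 1)"
  unfolding K.linear_sweedler[OF g, symmetric] inverse_section linear_scale[OF g] ..

lemma sweedler_section_inverse:
  assumes g: "Vector_Spaces.linear sG s g"
  shows "K.sweedler (\<lambda>x y. g (\<phi> x * \<psi> y)) k = s (\<epsilon>K k) (g 1)"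
  unfolding K.linear_sweedler[OF g, symmetric] section_inverse linear_scale[OF g] ..

text \<open>
  The convolution inverse of \<open>L \<circ> \<phi>\<close> is unique, and both \<open>L \<circ> \<psi>\<close> and \<open>k \<mapsto> S k\<^sub>2 \<otimes> \<psi> k\<^sub>1\<close> are such inverses.
  Written out: \<open>(S k\<^sub>2 \<otimes> \<psi> k\<^sub>1) L \<phi>(k\<^sub>3) L \<psi>(k\<^sub>4)\<close> collapses to \<open>L \<psi>(k)\<close> when its first two factors
  are cancelled and to \<open>S k\<^sub>2 \<otimes> \<psi> k\<^sub>1\<close> when its last two factors are cancelled. Evaluating a
  bilinear map \<open>h\<close> on these products avoids computing in the algebra \<open>C \<otimes> A\<close> itself.
\<close>

lemma inverse_colinear:
  assumes h: "bilinear_map sK sG s h"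
  shows "G.sweedler (\<lambda>x y. h (\<pi> x) y) (\<psi> k) = K.sweedler (\<lambda>x y. h (SK y) (\<psi> x)) k"
proof -
  note rules = linear_bilinear_left[OF h] linear_bilinear_right[OF h] cleft_multilinear
  \<comment> \<open>\<open>(S k\<^sub>2 \<otimes> \<psi> k\<^sub>1) L \<phi>(k\<^sub>3) = \<epsilon>(k) 1 \<otimes> 1\<close>, using \<open>L \<phi>(k) = k\<^sub>1 \<otimes> \<phi>(k\<^sub>2)\<close>\<close>
  have left: "K.sweedler (\<lambda>u v. K.sweedler (\<lambda>a b. K.sweedler (\<lambda>x y. H (SK b * x) (\<psi> a * \<phi> y)) v) u) k
    = s (\<epsilon>K k) (H 1 1)" if H: "bilinear_map sK sG s H" for H k
  proof -
    note rules = linear_bilinear_left[OF H] linear_bilinear_right[OF H] cleft_multilinear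
    have "K.sweedler (\<lambda>u v. K.sweedler (\<lambda>a b. K.sweedler (\<lambda>x y. H (SK b * x) (\<psi> a * \<phi> y)) v) u) k
      = K.sweedler (\<lambda>a y. H 1 (\<psi> a * \<phi> y)) k"
    proof (rule K.sweedler_cancel_middle[where s=s])
      show "K.sweedler (\<lambda>b x. H (SK b * x) (\<psi> a * \<phi> y)) m = s (\<epsilon>K m) (H 1 (\<psi> a * \<phi> y))" for m a y
        by (rule K.sweedler_antipode_left) (rule rules)+
    qed (rule rules)+
    also have "\<dots> = s (\<epsilon>K k) (H 1 1)"
      by (rule sweedler_inverse_section) (rule rules)+
    finally show ?thesis .
  qed
  \<comment> \<open>\<open>(u \<otimes> v) L \<phi>(k\<^sub>1) L \<psi>(k\<^sub>2) = \<epsilon>(k) u \<otimes> v\<close>, using that \<open>L\<close> is multiplicative\<close>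
  have right: "K.sweedler (\<lambda>c e. K.sweedler (\<lambda>x y. G.sweedler (\<lambda>p q. h (u * x * \<pi> p) (v * \<phi> y * q)) (\<psi> e)) c) k
    = s (\<epsilon>K k) (h u v)" for u v k
  proof -
    have inner: "K.sweedler (\<lambda>x y. G.sweedler (\<lambda>p q. h (u * x * \<pi> p) (v * \<phi> y * q)) (\<psi> e)) c
      = G.sweedler (\<lambda>a b. h (u * \<pi> a) (v * b)) (\<phi> c * \<psi> e)" for c e
    proof -
      have "K.sweedler (\<lambda>x y. G.sweedler (\<lambda>p q. h (u * x * \<pi> p) (v * \<phi> y * q)) (\<psi> e)) c
        = G.sweedler (\<lambda>x y. G.sweedler (\<lambda>p q. h (u * \<pi> x * \<pi> p) (v * y * q)) (\<psi> e)) (\<phi> c)"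
        by (rule sweedler_section[symmetric]) (rule rules)+
      also have "\<dots> = G.sweedler (\<lambda>x y. G.sweedler (\<lambda>p q. h (u * \<pi> (x * p)) (v * (y * q))) (\<psi> e)) (\<phi> c)"
        by (simp only: proj_mult mult.assoc)
      also have "\<dots> = G.sweedler (\<lambda>a b. h (u * \<pi> a) (v * b)) (\<phi> c * \<psi> e)"
        by (rule G.sweedler_mult[symmetric]) (rule rules)+
      finally show ?thesis .
    qed
    have "K.sweedler (\<lambda>c e. G.sweedler (\<lambda>a b. h (u * \<pi> a) (v * b)) (\<phi> c * \<psi> e)) k
      = s (\<epsilon>K k) (G.sweedler (\<lambda>a b. h (u * \<pi> a) (v * b)) 1)"
      by (rule sweedler_section_inverse) (rule rules)+
    also have "G.sweedler (\<lambda>a b. h (u * \<pi> a) (v * b)) 1 = h (u * \<pi> 1) (v * 1)"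
      by (rule G.sweedler_one) (rule rules)+
    finally show ?thesis unfolding inner by (simp add: proj_one)
  qed
  let ?t = "\<lambda>a b x y e. G.sweedler (\<lambda>p q. h (SK b * x * \<pi> p) (\<psi> a * \<phi> y * q)) (\<psi> e)"
  have "G.sweedler (\<lambda>x y. h (\<pi> x) y) (\<psi> k)
    = K.sweedler (\<lambda>m e. s (\<epsilon>K m) (G.sweedler (\<lambda>x y. h (\<pi> x) y) (\<psi> e))) k"
    by (rule K.sweedler_counit_left[symmetric]) (rule rules)+
  also have "\<dots> = K.sweedler (\<lambda>m e. K.sweedler (\<lambda>u v. K.sweedler (\<lambda>a b. K.sweedler (\<lambda>x y. ?t a b x y e) v) u) m) k"
  proof (rule K.sweedler_cong)
    fix m e
    have "bilinear_map sK sG s (\<lambda>z w. G.sweedler (\<lambda>p q. h (z * \<pi> p) (w * q)) (\<psi> e))"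
      by (rule rules)+
    from left[OF this, of m]
    show "s (\<epsilon>K m) (G.sweedler (\<lambda>x y. h (\<pi> x) y) (\<psi> e))
      = K.sweedler (\<lambda>u v. K.sweedler (\<lambda>a b. K.sweedler (\<lambda>x y. ?t a b x y e) v) u) m"
      by simp
  qed
  also have "\<dots> = K.sweedler (\<lambda>u w. K.sweedler (\<lambda>v e. K.sweedler (\<lambda>a b. K.sweedler (\<lambda>x y. ?t a b x y e) v) u) w) k"
    by (rule K.sweedler_coassoc[where s=s]; (rule rules)+)
  also have "\<dots> = K.sweedler (\<lambda>u w. K.sweedler (\<lambda>a b. K.sweedler (\<lambda>v e. K.sweedler (\<lambda>x y. ?t a b x y e) v) w) u) k"
    by (rule K.sweedler_cong) (rule K.sweedler_swap)
  also have "\<dots> = K.sweedler (\<lambda>u w. s (\<epsilon>K w) (K.sweedler (\<lambda>a b. h (SK b) (\<psi> a)) u)) k"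
  proof (rule K.sweedler_cong)
    fix u w
    have "Vector_Spaces.linear s s (s (\<epsilon>K w))"
      by (intro vector_space.linear_scale_self bilinear_vector_space(3)[OF h])
    from K.linear_sweedler[OF this]
    show "K.sweedler (\<lambda>a b. K.sweedler (\<lambda>v e. K.sweedler (\<lambda>x y. ?t a b x y e) v) w) u
      = s (\<epsilon>K w) (K.sweedler (\<lambda>a b. h (SK b) (\<psi> a)) u)"
      unfolding right by simp
  qed
  also have "\<dots> = K.sweedler (\<lambda>a b. h (SK b) (\<psi> a)) k"
    by (rule K.sweedler_counit_right) (rule rules)+
  finally show ?thesis .
qed

text \<open>
  \<open>L(\<psi>(\<pi> f\<^sub>1) f\<^sub>2) = \<pi>(S f\<^sub>2 f\<^sub>3) \<otimes> \<psi>(\<pi> f\<^sub>1) f\<^sub>4 = 1 \<otimes> \<psi>(\<pi> f\<^sub>1) f\<^sub>2\<close>, because \<open>L\<close> is multiplicative.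
\<close>

lemma inverse_proj_coinvariant:
  "G.sweedler (\<lambda>x y. \<psi> (\<pi> x) * y) f \<in> coinvariants sG \<Delta>G sK \<pi>"
proof -
  let ?T = "tensor sK sG"
  have 1: "G.sweedler (\<lambda>u w. ?T (\<pi> u) w) (\<psi> (\<pi> x) * y)
    = G.sweedler (\<lambda>a b. G.sweedler (\<lambda>c d. ?T (SK (\<pi> b) * \<pi> c) (\<psi> (\<pi> a) * d)) y) x" for x y
  proof -
    have "G.sweedler (\<lambda>u w. ?T (\<pi> u) w) (\<psi> (\<pi> x) * y)
      = G.sweedler (\<lambda>a b. G.sweedler (\<lambda>c d. ?T (\<pi> (a * c)) (b * d)) y) (\<psi> (\<pi> x))"
      by (rule G.sweedler_mult) (rule cleft_multilinear)+
    also have "\<dots> = G.sweedler (\<lambda>a b. G.sweedler (\<lambda>c d. ?T (\<pi> a * \<pi> c) (b * d)) y) (\<psi> (\<pi> x))"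
      by (simp only: proj_mult)
    also have "\<dots> = K.sweedler (\<lambda>a b. G.sweedler (\<lambda>c d. ?T (SK b * \<pi> c) (\<psi> a * d)) y) (\<pi> x)"
      by (rule inverse_colinear) (rule cleft_multilinear)+
    also have "\<dots> = G.sweedler (\<lambda>a b. G.sweedler (\<lambda>c d. ?T (SK (\<pi> b) * \<pi> c) (\<psi> (\<pi> a) * d)) y) x"
      by (rule sweedler_proj) (rule cleft_multilinear)+
    finally show ?thesis .
  qed
  have "Vector_Spaces.linear sG tscale (G.sweedler (\<lambda>u w. ?T (\<pi> u) w))"
    by (rule cleft_multilinear)+
  note linear = G.linear_sweedler[OF this]
  have "G.sweedler (\<lambda>u w. ?T (\<pi> u) w) (G.sweedler (\<lambda>x y. \<psi> (\<pi> x) * y) f)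
    = G.sweedler (\<lambda>x y. G.sweedler (\<lambda>a b. G.sweedler (\<lambda>c d. ?T (SK (\<pi> b) * \<pi> c) (\<psi> (\<pi> a) * d)) y) x) f"
    by (simp only: linear 1)
  also have "\<dots> = G.sweedler (\<lambda>a y. ?T 1 (\<psi> (\<pi> a) * y)) f"
  proof (rule G.sweedler_cancel_middle[where s=tscale])
    fix m a y
    have "G.sweedler (\<lambda>b x. ?T (\<pi> (SG b * x)) (\<psi> (\<pi> a) * y)) m = tscale (\<epsilon>G m) (?T (\<pi> 1) (\<psi> (\<pi> a) * y))"
      by (rule G.sweedler_antipode_left) (rule cleft_multilinear)+
    then show "G.sweedler (\<lambda>b x. ?T (SK (\<pi> b) * \<pi> x) (\<psi> (\<pi> a) * y)) m = tscale (\<epsilon>G m) (?T 1 (\<psi> (\<pi> a) * y))"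
      by (simp only: proj_mult proj_antipode proj_one)
  qed (rule cleft_multilinear)+
  also have "\<dots> = ?T 1 (G.sweedler (\<lambda>x y. \<psi> (\<pi> x) * y) f)"
    by (rule G.linear_sweedler[symmetric]) (rule cleft_multilinear)+
  finally show ?thesis unfolding coinvariant_iff .
qed

end

lemma (in quantum_subgroup) left_section_cleft:
  assumes "left_section sG \<Delta>G sK \<Delta>K \<epsilon>K \<pi> \<phi>"
  obtains \<psi> where "cleft_quantum_subgroup sG \<Delta>G \<epsilon>G SG sK \<Delta>K \<epsilon>K SK \<pi> \<phi> \<psi>"
proof -
  from assms obtain \<psi> where lin: "Vector_Spaces.linear sK sG \<phi>" "Vector_Spaces.linear sK sG \<psi>"
    and conv: "convolution sK \<Delta>K \<phi> \<psi> = (\<lambda>k. sG (\<epsilon>K k) 1)" "convolution sK \<Delta>K \<psi> \<phi> = (\<lambda>k. sG (\<epsilon>K k) 1)"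
    and col: "\<And>k. left_coaction sG \<Delta>G sK \<pi> (\<phi> k) = tensor_map sK sK sK sG id \<phi> (\<Delta>K k)"
    unfolding left_section_def convolution_invertible_def by blast
  have c: "convolution sK \<Delta>K f g k = K.sweedler (\<lambda>x y. f x * g y) k"
    if "Vector_Spaces.linear sK sG f" "Vector_Spaces.linear sK sG g" for f g k
  proof -
    have "bilinear_map sK sK sG (\<lambda>x y. f x * g y)"
      by (rule multilinear linear_comp[OF that(1)] linear_comp[OF that(2)])+
    then show ?thesis
      unfolding convolution_def K.sweedler_def by (rule tensor_lift_eq_tensor_sum[OF _ K.comult_in])
  qed
  have "cleft_quantum_subgroup sG \<Delta>G \<epsilon>G SG sK \<Delta>K \<epsilon>K SK \<pi> \<phi> \<psi>"
  proof (intro cleft_quantum_subgroup.intro cleft_quantum_subgroup_axioms.intro quantum_subgroup_axioms)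
    show "Vector_Spaces.linear sK sG \<phi>" "Vector_Spaces.linear sK sG \<psi>" by fact+
    show "K.sweedler (\<lambda>x y. \<phi> x * \<psi> y) k = sG (\<epsilon>K k) 1" for k
      using fun_cong[OF conv(1), of k] c[OF lin] by simp
    show "K.sweedler (\<lambda>x y. \<psi> x * \<phi> y) k = sG (\<epsilon>K k) 1" for k
      using fun_cong[OF conv(2), of k] c[OF lin(2,1)] by simp
    show "G.sweedler (\<lambda>x y. tensor sK sG (\<pi> x) y) (\<phi> k) = K.sweedler (\<lambda>x y. tensor sK sG x (\<phi> y)) k" for k
      using col[of k] unfolding left_coaction_eq tensor_map_eq_tensor_sum[OF K.linear_id lin(1) K.comult_in] K.sweedler_def
      by simp
  qed
  then show thesis by (rule that)
qed

context hopf_algebra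
begin

text \<open>
  A Hopf algebra is a quantum subgroup of itself, with the identity as a section and the antipode as
  its convolution inverse. For this instance \<open>inverse_colinear\<close> says that the antipode reverses
  coproducts.
\<close>

lemma trivial_quantum_subgroup:
  "cleft_quantum_subgroup scale comult counit antipode scale comult counit antipode id id antipode"
proof -
  have "quantum_subgroup scale comult counit antipode scale comult counit antipode id"
    unfolding quantum_subgroup_def quantum_subgroup_axioms_def
    using tensor_map_eq_tensor_sum[OF linear_id linear_id comult_in]
      tensor_sum_tensor[OF vector_space_axioms vector_space_axioms comult_in] hopf_algebra_axioms
    by (simp only: id_apply surj_id linear_id simp_thms)
  moreover have "sweedler (\<lambda>x y. x * antipode y) k = scale (counit k) 1"
     "sweedler (\<lambda>x y. antipode x * y) k = scale (counit k) 1" for k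
    by (rule sweedler_antipode_right sweedler_antipode_left, rule multilinear)+
  ultimately show ?thesis
    by (simp only: cleft_quantum_subgroup_def cleft_quantum_subgroup_axioms_def id_apply linear_id
        antipode_linear simp_thms)
qed

lemma sweedler_antipode:
  "bilinear_map scale scale s h \<Longrightarrow> sweedler h (antipode a) = sweedler (\<lambda>x y. h (antipode y) (antipode x)) a"
  using cleft_quantum_subgroup.inverse_colinear[OF trivial_quantum_subgroup] unfolding id_apply .

end


section \<open>Inverse antipodes\<close>

locale hopf_algebra_invertible_antipode = hopf_algebra +
  assumes bij_antipode: "bij antipode"
begin

definition antipode_inv where "antipode_inv = inv antipode"

lemma antipode_antipode_inv: "antipode (antipode_inv x) = x"
  unfolding antipode_inv_def by (rule surj_f_inv_f[OF bij_is_surj[OF bij_antipode]])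

lemma antipode_inv_antipode: "antipode_inv (antipode x) = x"
  unfolding antipode_inv_def by (rule inv_f_f[OF bij_is_inj[OF bij_antipode]])

lemma antipode_inv_eqI: "antipode y = x \<Longrightarrow> antipode_inv x = y"
  using antipode_inv_antipode by blast

lemma antipode_inv_linear: "Vector_Spaces.linear scale scale antipode_inv"
  unfolding Vector_Spaces.linear_iff
  by (intro conjI allI vector_space_axioms antipode_inv_eqI)
    (simp_all only: linear_add[OF antipode_linear] linear_scale[OF antipode_linear] antipode_antipode_inv)

lemma antipode_inv_mult: "antipode_inv (x * y) = antipode_inv y * antipode_inv x"
  by (rule antipode_inv_eqI) (simp only: antipode_mult antipode_antipode_inv)

lemma antipode_inv_one: "antipode_inv 1 = 1"
  by (rule antipode_inv_eqI) (rule antipode_one)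

lemma counit_antipode_inv: "counit (antipode_inv x) = counit x"
  using counit_antipode[of "antipode_inv x"] by (simp only: antipode_antipode_inv)

lemmas multilinear_inv = multilinear linear_comp[OF antipode_inv_linear]

lemma sweedler_antipode_inv:
  assumes h: "bilinear_map scale scale s h"
  shows "sweedler h (antipode_inv a) = sweedler (\<lambda>x y. h (antipode_inv y) (antipode_inv x)) a"
proof -
  have "bilinear_map scale scale s (\<lambda>x y. h (antipode_inv y) (antipode_inv x))"
    by (rule linear_bilinear_left[OF h] linear_bilinear_right[OF h] multilinear_inv)+
  from sweedler_antipode[OF this, of "antipode_inv a"] show ?thesis
    by (simp only: antipode_antipode_inv antipode_inv_antipode)
qed

text \<open>
  The inverse antipode satisfies the antipode laws for the opposite coproduct: apply it to
  \<open>x\<^sub>1 S x\<^sub>2 = \<epsilon>(x) 1\<close> and to \<open>S x\<^sub>1 x\<^sub>2 = \<epsilon>(x) 1\<close>.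
\<close>

lemma sweedler_antipode_inv_right:
  assumes g: "Vector_Spaces.linear scale s g"
  shows "sweedler (\<lambda>x y. g (y * antipode_inv x)) a = s (counit a) (g 1)"
proof -
  have "y * antipode_inv x = antipode_inv (x * antipode y)" for x y
    by (simp only: antipode_inv_mult antipode_inv_antipode)
  then show ?thesis
    using sweedler_antipode_right[OF linear_comp[OF g antipode_inv_linear], of a]
    by (simp only: antipode_inv_one)
qed

lemma sweedler_antipode_inv_left:
  assumes g: "Vector_Spaces.linear scale s g"
  shows "sweedler (\<lambda>x y. g (antipode_inv y * x)) a = s (counit a) (g 1)"
proof -
  have "antipode_inv y * x = antipode_inv (antipode x * y)" for x y
    by (simp only: antipode_inv_mult antipode_inv_antipode)
  then show ?thesis
    using sweedler_antipode_left[OF linear_comp[OF g antipode_inv_linear], of a]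
    by (simp only: antipode_inv_one)
qed

end

locale cleft_invertible_antipode = cleft_quantum_subgroup +
  G: hopf_algebra_invertible_antipode sG \<Delta>G \<epsilon>G SG
begin

text \<open>
  The formula is read off from \<open>\<pi> (T f) = \<epsilon>(\<psi>(\<pi> f\<^sub>2)) \<pi> (T \<phi>(\<pi> f\<^sub>1))\<close>, whose right-hand side makes
  sense for any element of the quotient in place of \<open>\<pi> f\<close>; see \<open>SK_inv_proj\<close>.
\<close>

definition SK_inv where "SK_inv k = K.sweedler (\<lambda>x y. sK (\<epsilon>G (\<psi> y)) (\<pi> (G.antipode_inv (\<phi> x)))) k"

lemmas cleft_multilinear_inv = cleft_multilinear linear_comp[OF G.antipode_inv_linear]

lemma SK_inv_linear: "Vector_Spaces.linear sK sK SK_inv"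
  unfolding SK_inv_def by (rule cleft_multilinear_inv)+

text \<open>
  Convolving \<open>\<phi> \<circ> \<pi>\<close> and \<open>\<psi> \<circ> \<pi>\<close> gives the counit. The value of the inner sum is coinvariant by
  \<open>inverse_proj_coinvariant\<close>.
\<close>

lemma factorisation: "G.sweedler (\<lambda>x y. \<phi> (\<pi> x) * G.sweedler (\<lambda>a b. \<psi> (\<pi> a) * b) y) f = f"
proof -
  have mult: "Vector_Spaces.linear sG sG (\<lambda>z. u * z)" for u by (rule multilinear)+
  have "G.sweedler (\<lambda>x y. \<phi> (\<pi> x) * G.sweedler (\<lambda>a b. \<psi> (\<pi> a) * b) y) f
    = G.sweedler (\<lambda>x y. G.sweedler (\<lambda>a b. \<phi> (\<pi> x) * (\<psi> (\<pi> a) * b)) y) f"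
    by (simp only: G.linear_sweedler[OF mult])
  also have "\<dots> = G.sweedler (\<lambda>m b. G.sweedler (\<lambda>x a. \<phi> (\<pi> x) * (\<psi> (\<pi> a) * b)) m) f"
    by (rule G.sweedler_coassoc[symmetric, where s=sG]; (rule cleft_multilinear)+)
  also have "\<dots> = G.sweedler (\<lambda>m b. sG (\<epsilon>G m) b) f"
  proof (rule G.sweedler_cong)
    fix m b
    have "G.sweedler (\<lambda>x a. \<phi> (\<pi> x) * \<psi> (\<pi> a) * b) m = K.sweedler (\<lambda>x a. \<phi> x * \<psi> a * b) (\<pi> m)"
      by (rule sweedler_proj[symmetric]) (rule cleft_multilinear)+
    also have "\<dots> = sG (\<epsilon>K (\<pi> m)) (1 * b)"
      by (rule sweedler_section_inverse) (rule multilinear)+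
    finally show "G.sweedler (\<lambda>x a. \<phi> (\<pi> x) * (\<psi> (\<pi> a) * b)) m = sG (\<epsilon>G m) b"
      by (simp only: proj_counit mult.assoc mult_1_left)
  qed
  also have "\<dots> = f"
    by (rule G.sweedler_counit_left) (rule multilinear)
  finally show ?thesis .
qed

text \<open>
  For a coinvariant, \<open>\<pi> b\<^sub>1 \<otimes> b\<^sub>2 = 1 \<otimes> b\<close>, so \<open>\<pi> (T b\<^sub>2 b\<^sub>1) = \<epsilon>(b) 1\<close> reduces to the claim.
\<close>

lemma proj_antipode_inv_coinvariant:
  assumes "b \<in> coinvariants sG \<Delta>G sK \<pi>"
  shows "\<pi> (G.antipode_inv b) = sK (\<epsilon>G b) 1"
proof -
  have "\<pi> (G.antipode_inv b) * 1 = G.sweedler (\<lambda>x y. \<pi> (G.antipode_inv y) * \<pi> x) b"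
    by (rule sweedler_coinvariant[OF assms, symmetric]) (rule cleft_multilinear_inv)+
  also have "\<dots> = G.sweedler (\<lambda>x y. \<pi> (G.antipode_inv y * x)) b" by (simp only: proj_mult)
  also have "\<dots> = sK (\<epsilon>G b) (\<pi> 1)" by (rule G.sweedler_antipode_inv_left) (rule proj_linear)
  finally show ?thesis by (simp only: proj_one mult_1_right)
qed

text \<open>
  \<open>T\<close> reverses the product in \<open>f = \<phi>(\<pi> f\<^sub>1) h(f\<^sub>2)\<close>, where \<open>h(f) = \<psi>(\<pi> f\<^sub>1) f\<^sub>2\<close> is coinvariant; after
  \<open>\<pi>\<close> its contribution is the scalar \<open>\<epsilon>(h(f\<^sub>2)) = \<epsilon>(\<psi>(\<pi> f\<^sub>2))\<close>.
\<close>

lemma SK_inv_proj: "SK_inv (\<pi> f) = \<pi> (G.antipode_inv f)"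
proof -
  let ?h = "G.sweedler (\<lambda>a b. \<psi> (\<pi> a) * b)"
  have eps: "\<epsilon>G (?h y) = \<epsilon>G (\<psi> (\<pi> y))" for y
  proof -
    have "\<epsilon>G (?h y) = G.sweedler (\<lambda>a b. \<epsilon>G (\<psi> (\<pi> a) * b)) y"
      by (rule G.linear_sweedler[OF G.counit_linear])
    also have "\<dots> = G.sweedler (\<lambda>a b. \<epsilon>G b * \<epsilon>G (\<psi> (\<pi> a))) y"
      by (simp only: G.counit_mult mult.commute)
    also have "\<dots> = \<epsilon>G (\<psi> (\<pi> y))"
      by (rule G.sweedler_counit_right) (rule cleft_multilinear)+
    finally show ?thesis .
  qed
  have "\<pi> (G.antipode_inv f) = \<pi> (G.antipode_inv (G.sweedler (\<lambda>x y. \<phi> (\<pi> x) * ?h y) f))"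
    by (simp only: factorisation)
  also have "\<dots> = G.sweedler (\<lambda>x y. \<pi> (G.antipode_inv (\<phi> (\<pi> x) * ?h y))) f"
    by (rule G.linear_sweedler[OF linear_comp[OF proj_linear G.antipode_inv_linear]])
  also have "\<dots> = G.sweedler (\<lambda>x y. sK (\<epsilon>G (\<psi> (\<pi> y))) (\<pi> (G.antipode_inv (\<phi> (\<pi> x))))) f"
    by (simp only: G.antipode_inv_mult proj_mult proj_antipode_inv_coinvariant[OF inverse_proj_coinvariant]
        eps K.scale_mult_left mult_1_left)
  also have "\<dots> = SK_inv (\<pi> f)"
    unfolding SK_inv_def by (rule sweedler_proj[symmetric]) (rule cleft_multilinear_inv)+
  finally show ?thesis ..
qed

lemma proj_cases: obtains f where "k = \<pi> f"
  using proj_surj by (metis surjD)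

lemmas full_multilinear = cleft_multilinear_inv linear_comp[OF SK_inv_linear]

lemma SK_SK_inv: "SK (SK_inv k) = k"
  by (rule proj_cases[of k]) (simp only: SK_inv_proj proj_antipode[symmetric] G.antipode_antipode_inv)

lemma counit_SK_inv: "\<epsilon>K (SK_inv k) = \<epsilon>K k"
  by (rule proj_cases[of k]) (simp only: SK_inv_proj proj_counit G.counit_antipode_inv)

lemma sweedler_SK_inv:
  assumes h: "bilinear_map sK sK s h"
  shows "K.sweedler h (SK_inv k) = K.sweedler (\<lambda>x y. h (SK_inv y) (SK_inv x)) k"
proof -
  note rules = linear_bilinear_left[OF h] linear_bilinear_right[OF h] full_multilinear
  obtain f where f: "k = \<pi> f" by (rule proj_cases)
  have "K.sweedler h (SK_inv k) = G.sweedler (\<lambda>x y. h (\<pi> x) (\<pi> y)) (G.antipode_inv f)"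
    unfolding f SK_inv_proj by (rule sweedler_proj[OF h])
  also have "\<dots> = G.sweedler (\<lambda>x y. h (SK_inv (\<pi> y)) (SK_inv (\<pi> x))) f"
    unfolding SK_inv_proj by (rule G.sweedler_antipode_inv) (rule rules)+
  also have "\<dots> = K.sweedler (\<lambda>x y. h (SK_inv y) (SK_inv x)) (\<pi> f)"
    by (rule sweedler_proj[symmetric]) (rule rules)+
  finally show ?thesis unfolding f .
qed

lemma sweedler_SK_inv_right:
  assumes g: "Vector_Spaces.linear sK s g"
  shows "K.sweedler (\<lambda>x y. g (y * SK_inv x)) k = s (\<epsilon>K k) (g 1)"
proof -
  note rules = linear_comp[OF g] full_multilinear
  obtain f where f: "k = \<pi> f" by (rule proj_cases)
  have "K.sweedler (\<lambda>x y. g (y * SK_inv x)) k = G.sweedler (\<lambda>x y. g (\<pi> y * SK_inv (\<pi> x))) f"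
    unfolding f by (rule sweedler_proj) (rule rules)+
  also have "\<dots> = G.sweedler (\<lambda>x y. g (\<pi> (y * G.antipode_inv x))) f" by (simp only: SK_inv_proj proj_mult)
  also have "\<dots> = s (\<epsilon>G f) (g (\<pi> 1))"
    by (rule G.sweedler_antipode_inv_right) (rule linear_comp[OF g proj_linear])
  finally show ?thesis by (simp only: f proj_counit proj_one)
qed

text \<open>
  Both \<open>L \<circ> \<psi>\<close> and \<open>SK_inv\<close> reverse the coproduct, and \<open>SK_inv\<close> undoes the antipode in \<open>L \<circ> \<psi>\<close>;
  so \<open>\<psi> \<circ> SK_inv\<close> is colinear, as \<open>\<phi>\<close> is.
\<close>

lemma inverse_SK_inv_colinear:
  assumes h: "bilinear_map sK sG s h"
  shows "G.sweedler (\<lambda>x y. h (\<pi> x) y) (\<psi> (SK_inv k)) = K.sweedler (\<lambda>x y. h x (\<psi> (SK_inv y))) k"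
proof -
  note rules = linear_bilinear_left[OF h] linear_bilinear_right[OF h] full_multilinear
  have "G.sweedler (\<lambda>x y. h (\<pi> x) y) (\<psi> (SK_inv k)) = K.sweedler (\<lambda>x y. h (SK y) (\<psi> x)) (SK_inv k)"
    by (rule inverse_colinear[OF h])
  also have "\<dots> = K.sweedler (\<lambda>x y. h (SK (SK_inv x)) (\<psi> (SK_inv y))) k"
    by (rule sweedler_SK_inv) (rule rules)+
  finally show ?thesis by (simp only: SK_SK_inv)
qed

lemma section_SK_inv_colinear:
  assumes h: "bilinear_map sK sG s h"
  shows "G.sweedler (\<lambda>x y. h (\<pi> x) y) (\<phi> (SK_inv k)) = K.sweedler (\<lambda>x y. h (SK_inv y) (\<phi> (SK_inv x))) k"
proof -
  note rules = linear_bilinear_left[OF h] linear_bilinear_right[OF h] full_multilinear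
  have "G.sweedler (\<lambda>x y. h (\<pi> x) y) (\<phi> (SK_inv k)) = K.sweedler (\<lambda>x y. h x (\<phi> y)) (SK_inv k)"
    by (rule sweedler_section[OF h])
  also have "\<dots> = K.sweedler (\<lambda>x y. h (SK_inv y) (\<phi> (SK_inv x))) k"
    by (rule sweedler_SK_inv) (rule rules)+
  finally show ?thesis .
qed

text \<open>
  The mirror image of \<open>inverse_proj_coinvariant\<close>: now the middle factors cancel by
  \<open>k\<^sub>2 SK_inv k\<^sub>1 = \<epsilon>(k) 1\<close>.
\<close>

lemma section_SK_inv_proj_coinvariant:
  "G.sweedler (\<lambda>x y. y * \<phi> (SK_inv (\<pi> x))) f \<in> coinvariants sG \<Delta>G sK \<pi>"
proof -
  let ?T = "tensor sK sG" and ?R = "\<lambda>x. SK_inv (\<pi> x)"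
  have 1: "G.sweedler (\<lambda>u w. ?T (\<pi> u) w) (y * \<phi> (?R x))
    = G.sweedler (\<lambda>a b. G.sweedler (\<lambda>c d. ?T (\<pi> c * ?R b) (d * \<phi> (?R a))) y) x" for x y
  proof -
    have "G.sweedler (\<lambda>u w. ?T (\<pi> u) w) (y * \<phi> (?R x))
      = G.sweedler (\<lambda>c d. G.sweedler (\<lambda>a b. ?T (\<pi> (c * a)) (d * b)) (\<phi> (?R x))) y"
      by (rule G.sweedler_mult) (rule full_multilinear)+
    also have "\<dots> = G.sweedler (\<lambda>a b. G.sweedler (\<lambda>c d. ?T (\<pi> c * \<pi> a) (d * b)) y) (\<phi> (?R x))"
      unfolding proj_mult by (rule G.sweedler_swap)
    also have "\<dots> = K.sweedler (\<lambda>a b. G.sweedler (\<lambda>c d. ?T (\<pi> c * SK_inv b) (d * \<phi> (SK_inv a))) y) (\<pi> x)"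
      by (rule section_SK_inv_colinear) (rule full_multilinear)+
    also have "\<dots> = G.sweedler (\<lambda>a b. G.sweedler (\<lambda>c d. ?T (\<pi> c * ?R b) (d * \<phi> (?R a))) y) x"
      by (rule sweedler_proj) (rule full_multilinear)+
    finally show ?thesis .
  qed
  have "Vector_Spaces.linear sG tscale (G.sweedler (\<lambda>u w. ?T (\<pi> u) w))"
    by (rule full_multilinear)+
  note linear = G.linear_sweedler[OF this]
  have "G.sweedler (\<lambda>u w. ?T (\<pi> u) w) (G.sweedler (\<lambda>x y. y * \<phi> (?R x)) f)
    = G.sweedler (\<lambda>x y. G.sweedler (\<lambda>a b. G.sweedler (\<lambda>c d. ?T (\<pi> c * ?R b) (d * \<phi> (?R a))) y) x) f"
    by (simp only: linear 1)
  also have "\<dots> = G.sweedler (\<lambda>a y. ?T 1 (y * \<phi> (?R a))) f"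
  proof (rule G.sweedler_cancel_middle[where s=tscale])
    fix m a y
    have "G.sweedler (\<lambda>b x. ?T (\<pi> x * ?R b) (y * \<phi> (?R a))) m
      = K.sweedler (\<lambda>b x. ?T (x * SK_inv b) (y * \<phi> (?R a))) (\<pi> m)"
      by (rule sweedler_proj[symmetric]) (rule full_multilinear)+
    also have "\<dots> = tscale (\<epsilon>K (\<pi> m)) (?T 1 (y * \<phi> (?R a)))"
      by (rule sweedler_SK_inv_right) (rule full_multilinear)+
    finally show "G.sweedler (\<lambda>b x. ?T (\<pi> x * ?R b) (y * \<phi> (?R a))) m = tscale (\<epsilon>G m) (?T 1 (y * \<phi> (?R a)))"
      by (simp only: proj_counit)
  qed (rule full_multilinear)+
  also have "\<dots> = ?T 1 (G.sweedler (\<lambda>x y. y * \<phi> (?R x)) f)"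
    by (rule G.linear_sweedler[symmetric]) (rule full_multilinear)+
  finally show ?thesis unfolding coinvariant_iff .
qed

end


section \<open>Induced spaces\<close>

lemma vs_iso_comp:
  assumes f: "vs_iso s X t Y f" and g: "vs_iso t Y u Z g"
  shows "vs_iso s X u Z (\<lambda>x. g (f x))"
proof -
  have "f x \<in> Y" if "x \<in> X" for x using f that unfolding vs_iso_def by (blast dest: bij_betwE)
  moreover have "bij_betw (\<lambda>x. g (f x)) X Z"
    using f g bij_betw_trans[of f X Y g Z] unfolding vs_iso_def comp_def by blast
  ultimately show ?thesis using f g unfolding vs_iso_def linear_on_def by simp
qed

context quantum_subgroup
begin

lemma left_coaction_linear: "Vector_Spaces.linear sG tscale (left_coaction sG \<Delta>G sK \<pi>)"
  unfolding left_coaction_eq by (rule multilinear)+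

lemma coinvariants_mult:
  assumes "b \<in> coinvariants sG \<Delta>G sK \<pi>" "c \<in> coinvariants sG \<Delta>G sK \<pi>"
  shows "b * c \<in> coinvariants sG \<Delta>G sK \<pi>"
proof -
  let ?T = "tensor sK sG"
  have "G.sweedler (\<lambda>x y. ?T (\<pi> x) y) (b * c)
    = G.sweedler (\<lambda>x y. G.sweedler (\<lambda>u w. ?T (\<pi> (x * u)) (y * w)) c) b"
    by (rule G.sweedler_mult) (rule multilinear)+
  also have "\<dots> = G.sweedler (\<lambda>x y. ?T (\<pi> x * 1) (y * c)) b"
    unfolding proj_mult by (rule G.sweedler_cong, rule sweedler_coinvariant[OF assms(2)]) (rule multilinear)+
  also have "\<dots> = ?T (1 * 1) (b * c)"
    by (rule sweedler_coinvariant[OF assms(1)]) (rule multilinear)+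
  finally show ?thesis unfolding coinvariant_iff by simp
qed

end

locale induced_corepresentation =
  quantum_subgroup sG \<Delta>G \<epsilon>G SG sK \<Delta>K \<epsilon>K SK \<pi> +
  V: right_corepresentation sV sK \<Delta>K \<epsilon>K \<rho>
  for sG :: "'k::field \<Rightarrow> 'g::ring_1 \<Rightarrow> 'g" and \<Delta>G \<epsilon>G SG
    and sK :: "'k \<Rightarrow> 'h::ring_1 \<Rightarrow> 'h" and \<Delta>K \<epsilon>K SK and \<pi>
    and sV :: "'k \<Rightarrow> 'v::ab_group_add \<Rightarrow> 'v" and \<rho>
begin

abbreviation "VG \<equiv> tensor_space sV sG UNIV UNIV"
abbreviation "B \<equiv> coinvariants sG \<Delta>G sK \<pi>"
abbreviation "VB \<equiv> tensor_space sV sG UNIV B"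
abbreviation "H \<equiv> induced_space sG \<Delta>G sK \<pi> sV \<rho>"
abbreviation "L \<equiv> left_coaction sG \<Delta>G sK \<pi>"

lemma VB_subset: "VB \<subseteq> VG"
  unfolding tensor_space_def by (rule tensor.span_mono) blast

lemmas V_multilinear = multilinear linear_var[OF V.V.vector_space_axioms]
  V.linear_coact_sum_parameter V.linear_coact_sum_argument
  linear_bilinear_left[OF bilinear_map_tensor[OF V.V.vector_space_axioms G.vector_space_axioms]]
  linear_bilinear_right[OF bilinear_map_tensor[OF V.V.vector_space_axioms G.vector_space_axioms]]
  linear_bilinear_left[OF bilinear_map_tensor[OF V.V.vector_space_axioms vector_space_tscale]]
  linear_bilinear_right[OF bilinear_map_tensor[OF V.V.vector_space_axioms vector_space_tscale]]

lemma induced_space_iff: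
  "F \<in> H \<longleftrightarrow> F \<in> VG \<and> tensor_sum sV sG (\<lambda>v f. tensor sV tscale v (L f)) F
    = tensor_sum sV sG (\<lambda>v f. V.coact_sum (\<lambda>w k. tensor sV tscale w (tensor sK sG k f)) v) F"
proof -
  note vs = G.vector_space_axioms V.V.vector_space_axioms K.vector_space_axioms
  have "tensor_map sV sG sV tscale id L F = tensor_sum sV sG (\<lambda>v f. tensor sV tscale v (L f)) F"
    "tensor_map_assoc sV sG sV sK \<rho> F
      = tensor_sum sV sG (\<lambda>v f. V.coact_sum (\<lambda>w k. tensor sV tscale w (tensor sK sG k f)) v) F"
    if "F \<in> VG"
    using tensor_map_eq_tensor_sum[OF V.V.linear_id left_coaction_linear that]
      tensor_map_assoc_eq_tensor_sum[OF V.coact_linear V.coact_in vs that]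
    unfolding V.coact_sum_def by simp_all
  then show ?thesis unfolding induced_space_def by auto
qed

text \<open>
  The equation \<open>v \<otimes> \<pi> f\<^sub>1 \<otimes> f\<^sub>2 = v\<^sub>0 \<otimes> v\<^sub>1 \<otimes> f\<close> that defines the induced space, after applying a trilinear
  map to both sides.
\<close>

lemma induced_space_trilinear:
  assumes F: "F \<in> H"
    and t: "\<And>y z. Vector_Spaces.linear sV s (\<lambda>x. t x y z)" "\<And>x z. Vector_Spaces.linear sK s (\<lambda>y. t x y z)"
    "\<And>x y. Vector_Spaces.linear sG s (t x y)"
  shows "tensor_sum sV sG (\<lambda>v f. G.sweedler (\<lambda>x y. t v (\<pi> x) y) f) F
    = tensor_sum sV sG (\<lambda>v f. V.coact_sum (\<lambda>w k. t w k f) v) F"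
proof -
  have tens: "Vector_Spaces.linear tscale tscale (tensor sV tscale v)" for v
    using bilinear_map_tensor[OF V.V.vector_space_axioms vector_space_tscale] unfolding bilinear_map_def by blast
  have "tensor sV tscale v (L f) = G.sweedler (\<lambda>x y. tensor sV tscale v (tensor sK sG (\<pi> x) y)) f" for v f
    unfolding left_coaction_eq by (rule G.linear_sweedler[OF tens])
  note r = F[unfolded induced_space_iff this, THEN conjunct2]
  show ?thesis
    using trilinear_eq[OF t(1) bilinear_mapI[OF t(2,3)] r[unfolded G.sweedler_def V.coact_sum_def]]
    unfolding G.sweedler_def V.coact_sum_def .
qed

text \<open>
  \<open>v \<otimes> f \<mapsto> v\<^sub>0 \<otimes> c(v\<^sub>1, f)\<close>
\<close>

definition twist :: "('h \<Rightarrow> 'g \<Rightarrow> 'g) \<Rightarrow> ('v, 'g, 'k) tensor \<Rightarrow> ('v, 'g, 'k) tensor"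
  where "twist c F = tensor_sum sV sG (\<lambda>v f. V.coact_sum (\<lambda>w k. tensor sV sG w (c k f)) v) F"

lemma twist_bilinear:
  assumes c: "bilinear_map sK sG sG c"
  shows "bilinear_map sV sG tscale (\<lambda>v f. V.coact_sum (\<lambda>w k. tensor sV sG w (c k f)) v)"
  by (rule V_multilinear linear_bilinear_left[OF c] linear_bilinear_right[OF c])+

lemma twist_in: "twist c F \<in> VG"
  unfolding twist_def V.coact_sum_def by (intro tensor_sum_in_space tensor_in_space UNIV_I)

lemma twist_tensor:
  assumes c: "bilinear_map sK sG sG c"
  shows "twist c (tensor sV sG v f) = V.coact_sum (\<lambda>w k. tensor sV sG w (c k f)) v"
  unfolding twist_def by (rule tensor_sum_of_tensor[OF twist_bilinear[OF c]])

lemma twist_linear: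
  assumes "bilinear_map sK sG sG c"
  shows "linear_on VG tscale tscale (twist c)"
  using tensor_sum_linear_on[OF twist_bilinear[OF assms]] unfolding linear_on_def twist_def .

lemma linear_on_coact_sum:
  assumes "linear_on VG tscale s f" "vector_space s" "\<And>w k. h w k \<in> VG"
  shows "f (V.coact_sum h v) = V.coact_sum (\<lambda>w k. f (h w k)) v"
  unfolding V.coact_sum_def by (rule linear_on_tensor_sum[OF assms])

text \<open>
  \<open>v\<^sub>0 \<otimes> c(v\<^sub>1, d(v\<^sub>2, f)) = v\<^sub>0 \<otimes> \<epsilon>(v\<^sub>1) f = v \<otimes> f\<close>
\<close>

lemma twist_twist:
  assumes c: "bilinear_map sK sG sG c" and d: "bilinear_map sK sG sG d"
    and cd: "\<And>k f. K.sweedler (\<lambda>x y. c x (d y f)) k = sG (\<epsilon>K k) f"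
    and F: "F \<in> VG"
  shows "twist c (twist d F) = F"
proof (rule tensor_unique[OF V.V.vector_space_axioms G.vector_space_axioms vector_space_tscale _ _ _ F,
      where f = "\<lambda>F. twist c (twist d F)" and g = "\<lambda>F. F"])
  note rules = V_multilinear linear_bilinear_left[OF c] linear_bilinear_right[OF c]
    linear_bilinear_left[OF d] linear_bilinear_right[OF d]
  show "linear_on VG tscale tscale (\<lambda>F. twist c (twist d F))"
    by (rule linear_on_comp[OF twist_linear[OF d] twist_linear[OF c] twist_in])
  show "linear_on VG tscale tscale (\<lambda>F. F)" by (rule linear_on_ident)
  fix v f
  let ?T = "tensor sV sG"
  have "twist c (twist d (?T v f)) = V.coact_sum (\<lambda>w k. twist c (?T w (d k f))) v"
    unfolding twist_tensor[OF d]
    by (rule linear_on_coact_sum[OF twist_linear[OF c] vector_space_tscale]) (intro tensor_in_space UNIV_I)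
  also have "\<dots> = V.coact_sum (\<lambda>w k. V.coact_sum (\<lambda>u l. ?T u (c l (d k f))) w) v"
    unfolding twist_tensor[OF c] ..
  also have "\<dots> = V.coact_sum (\<lambda>w k. K.sweedler (\<lambda>x y. ?T w (c x (d y f))) k) v"
    by (rule V.coact_sum_coassoc[where s=tscale]; (rule rules)+)
  also have "\<dots> = V.coact_sum (\<lambda>w k. tscale (\<epsilon>K k) (?T w f)) v"
  proof (rule V.coact_sum_cong)
    fix w k
    have lin: "Vector_Spaces.linear sG tscale (\<lambda>z. ?T w z)" by (rule rules)+
    show "K.sweedler (\<lambda>x y. ?T w (c x (d y f))) k = tscale (\<epsilon>K k) (?T w f)"
      unfolding K.linear_sweedler[OF lin, symmetric] cd linear_scale[OF lin] ..
  qed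
  also have "\<dots> = ?T v f"
    by (rule V.coact_sum_counit) (rule rules)+
  finally show "twist c (twist d (?T v f)) = ?T v f" .
qed

text \<open>
  For an element of the induced space, \<open>v\<^sub>0 \<otimes> c(v\<^sub>1, f)\<close> may be replaced by \<open>v \<otimes> c(\<pi> f\<^sub>1, f\<^sub>2)\<close>.
\<close>

lemma twist_induced_space:
  assumes c: "bilinear_map sK sG sG c"
    and cB: "\<And>f. G.sweedler (\<lambda>x y. c (\<pi> x) y) f \<in> B"
    and F: "F \<in> H"
  shows "twist c F \<in> VB"
proof -
  note rules = V_multilinear linear_bilinear_left[OF c] linear_bilinear_right[OF c]
  have lin: "Vector_Spaces.linear sG tscale (\<lambda>z. tensor sV sG w z)" for w by (rule rules)+
  have "twist c F = tensor_sum sV sG (\<lambda>v f. G.sweedler (\<lambda>x y. tensor sV sG v (c (\<pi> x) y)) f) F"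
    unfolding twist_def by (rule induced_space_trilinear[OF F, symmetric]; (rule rules)+)
  also have "\<dots> \<in> VB"
    unfolding G.linear_sweedler[OF lin, symmetric] by (intro tensor_sum_in_space tensor_in_space UNIV_I cB)
  finally show ?thesis .
qed

text \<open>
  By the condition on \<open>c\<close>, both sides of the equation that defines the induced space become
  \<open>v\<^sub>0 \<otimes> v\<^sub>1 \<otimes> c(v\<^sub>2, b)\<close> on the twist of \<open>v \<otimes> b\<close>.
\<close>

lemma twist_in_induced_space:
  assumes c: "bilinear_map sK sG sG c"
    and cL: "\<And>k b. b \<in> B \<Longrightarrow> L (c k b) = K.sweedler (\<lambda>x y. tensor sK sG x (c y b)) k"
    and F: "F \<in> VB"
  shows "twist c F \<in> H"
proof -
  note rules = V_multilinear linear_bilinear_left[OF c] linear_bilinear_right[OF c]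
  let ?T = "tensor sV tscale"
  let ?E1 = "tensor_sum sV sG (\<lambda>v f. ?T v (L f))"
  let ?E2 = "tensor_sum sV sG (\<lambda>v f. V.coact_sum (\<lambda>w k. ?T w (tensor sK sG k f)) v)"
  have b1: "bilinear_map sV sG tscale (\<lambda>v f. ?T v (L f))"
    by (rule rules linear_comp[OF left_coaction_linear])+
  have b2: "bilinear_map sV sG tscale (\<lambda>v f. V.coact_sum (\<lambda>w k. ?T w (tensor sK sG k f)) v)"
    by (rule rules)+
  note l1 = tensor_sum_linear_on[OF b1] and l2 = tensor_sum_linear_on[OF b2]
  have lin: "linear_on VB tscale tscale (twist c)" by (rule linear_on_subset[OF twist_linear[OF c] VB_subset])
  have "?E1 (twist c F) = ?E2 (twist c F)"
  proof (rule tensor_unique[OF V.V.vector_space_axioms G.vector_space_axioms vector_space_tscale _ _ _ F,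
        where f = "\<lambda>F. ?E1 (twist c F)" and g = "\<lambda>F. ?E2 (twist c F)"])
    show "linear_on VB tscale tscale (\<lambda>F. ?E1 (twist c F))" by (rule linear_on_comp[OF lin l1 twist_in])
    show "linear_on VB tscale tscale (\<lambda>F. ?E2 (twist c F))" by (rule linear_on_comp[OF lin l2 twist_in])
    fix v b assume b: "b \<in> B"
    have tens: "Vector_Spaces.linear tscale tscale (?T w)" for w
      using bilinear_map_tensor[OF V.V.vector_space_axioms vector_space_tscale] unfolding bilinear_map_def by blast
    have "?E1 (twist c (tensor sV sG v b)) = V.coact_sum (\<lambda>w k. ?E1 (tensor sV sG w (c k b))) v"
      unfolding twist_tensor[OF c]
      by (rule linear_on_coact_sum[OF l1 vector_space_tscale]) (intro tensor_in_space UNIV_I)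
    also have "\<dots> = V.coact_sum (\<lambda>w k. ?T w (K.sweedler (\<lambda>x y. tensor sK sG x (c y b)) k)) v"
      by (simp only: tensor_sum_of_tensor[OF b1] cL[OF b])
    also have "\<dots> = V.coact_sum (\<lambda>w k. K.sweedler (\<lambda>x y. ?T w (tensor sK sG x (c y b))) k) v"
      by (simp only: K.linear_sweedler[OF tens])
    also have "\<dots> = V.coact_sum (\<lambda>w k. V.coact_sum (\<lambda>u l. ?T u (tensor sK sG l (c k b))) w) v"
      by (rule V.coact_sum_coassoc[symmetric, where s=tscale]; (rule rules)+)
    also have "\<dots> = V.coact_sum (\<lambda>w k. ?E2 (tensor sV sG w (c k b))) v"
      by (simp only: tensor_sum_of_tensor[OF b2])
    also have "\<dots> = ?E2 (twist c (tensor sV sG v b))"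
      unfolding twist_tensor[OF c]
      by (rule linear_on_coact_sum[OF l2 vector_space_tscale, symmetric]) (intro tensor_in_space UNIV_I)
    finally show "?E1 (twist c (tensor sV sG v b)) = ?E2 (twist c (tensor sV sG v b))" .
  qed
  then show ?thesis unfolding induced_space_iff using twist_in by blast
qed

lemma induced_space_subset: "H \<subseteq> VG"
  unfolding induced_space_def by blast

lemma twist_iso:
  assumes c: "bilinear_map sK sG sG c" and d: "bilinear_map sK sG sG d"
    and cd: "\<And>k f. K.sweedler (\<lambda>x y. c x (d y f)) k = sG (\<epsilon>K k) f"
    and dc: "\<And>k f. K.sweedler (\<lambda>x y. d x (c y f)) k = sG (\<epsilon>K k) f"
    and cL: "\<And>k b. b \<in> B \<Longrightarrow> L (c k b) = K.sweedler (\<lambda>x y. tensor sK sG x (c y b)) k"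
    and dB: "\<And>f. G.sweedler (\<lambda>x y. d (\<pi> x) y) f \<in> B"
  shows "vs_iso tscale H tscale VB (twist d)"
proof -
  have "bij_betw (twist d) H VB"
  proof (rule bij_betw_byWitness[where f' = "twist c"])
    show "\<forall>F\<in>H. twist c (twist d F) = F" using twist_twist[OF c d cd] induced_space_subset by blast
    show "\<forall>F\<in>VB. twist d (twist c F) = F" using twist_twist[OF d c dc] VB_subset by blast
    show "twist d ` H \<subseteq> VB" using twist_induced_space[OF d dB] by blast
    show "twist c ` VB \<subseteq> H" using twist_in_induced_space[OF c cL] by blast
  qed
  then show ?thesis
    unfolding vs_iso_def using linear_on_subset[OF twist_linear[OF d] induced_space_subset] by blast
qed

text \<open>
  The action \<open>v \<otimes> f \<mapsto> v \<otimes> m(b, f)\<close> visibly preserves \<open>V \<otimes> B\<close> and commutes with both twists. That it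
  preserves the induced space follows by transport along the inverse twist.
\<close>

lemma twist_module_iso:
  assumes c: "bilinear_map sK sG sG c" and d: "bilinear_map sK sG sG d"
    and cd: "\<And>k f. K.sweedler (\<lambda>x y. c x (d y f)) k = sG (\<epsilon>K k) f"
    and dc: "\<And>k f. K.sweedler (\<lambda>x y. d x (c y f)) k = sG (\<epsilon>K k) f"
    and cL: "\<And>k b. b \<in> B \<Longrightarrow> L (c k b) = K.sweedler (\<lambda>x y. tensor sK sG x (c y b)) k"
    and dB: "\<And>f. G.sweedler (\<lambda>x y. d (\<pi> x) y) f \<in> B"
    and m: "bilinear_map sG sG sG m" and mB: "\<And>b b'. b \<in> B \<Longrightarrow> b' \<in> B \<Longrightarrow> m b b' \<in> B"
    and cm: "\<And>b k f. c k (m b f) = m b (c k f)" and dm: "\<And>b k f. d k (m b f) = m b (d k f)"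
  shows "module_iso B (\<lambda>b. tensor_map sV sG sV sG id (m b)) H VB (twist d)"
  unfolding module_iso_def
proof (intro conjI ballI)
  let ?act = "\<lambda>b. tensor_map sV sG sV sG id (m b)"
  note rules = V_multilinear linear_bilinear_right[OF m]
  show iso: "vs_iso tscale H tscale VB (twist d)" by (rule twist_iso[OF c d cd dc cL dB])
  fix b assume b: "b \<in> B"
  have lm: "Vector_Spaces.linear sG sG (m b)" using m unfolding bilinear_map_def by blast
  have bil: "bilinear_map sV sG tscale (\<lambda>v f. tensor sV sG v (m b f))" by (rule rules)+
  have act: "?act b F = tensor_sum sV sG (\<lambda>v f. tensor sV sG v (m b f)) F" if "F \<in> VG" for F
    using tensor_map_eq_tensor_sum[OF V.V.linear_id lm that] by simp
  have act_in: "?act b F \<in> VG" if "F \<in> VG" for F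
    unfolding act[OF that] by (intro tensor_sum_in_space tensor_in_space UNIV_I)
  have act_linear: "linear_on VG tscale tscale (?act b)"
    unfolding tensor_map_def id_apply by (rule tensor_lift_linear[OF bil])
  have act_tensor: "?act b (tensor sV sG v f) = tensor sV sG v (m b f)" for v f
    using tensor_map_tensor[OF V.V.linear_id lm] by simp
  have act_twist: "twist e (?act b F) = ?act b (twist e F)"
    if e: "bilinear_map sK sG sG e" and em: "\<And>k f. e k (m b f) = m b (e k f)" and F: "F \<in> VG" for e F
  proof (rule tensor_unique[OF V.V.vector_space_axioms G.vector_space_axioms vector_space_tscale _ _ _ F,
        where f = "\<lambda>F. twist e (?act b F)" and g = "\<lambda>F. ?act b (twist e F)"])
    show "linear_on VG tscale tscale (\<lambda>F. twist e (?act b F))"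
      by (rule linear_on_comp[OF act_linear twist_linear[OF e] act_in])
    show "linear_on VG tscale tscale (\<lambda>F. ?act b (twist e F))"
      by (rule linear_on_comp[OF twist_linear[OF e] act_linear twist_in])
    fix v f
    have "?act b (twist e (tensor sV sG v f)) = V.coact_sum (\<lambda>w k. ?act b (tensor sV sG w (e k f))) v"
      unfolding twist_tensor[OF e]
      by (rule linear_on_coact_sum[OF act_linear vector_space_tscale]) (intro tensor_in_space UNIV_I)
    then show "twist e (?act b (tensor sV sG v f)) = ?act b (twist e (tensor sV sG v f))"
      by (simp only: act_tensor twist_tensor[OF e] em)
  qed
  have act_VB: "?act b F \<in> VB" if F: "F \<in> VB" for F
  proof -
    from tensor_space_sum_list[OF V.V.vector_space_axioms G.vector_space_axioms F V.V.subspace_UNIV]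
    obtain xs where xs: "set xs \<subseteq> UNIV \<times> B" "F = (\<Sum>(u, w)\<leftarrow>xs. tensor sV sG u w)" by blast
    have "?act b F = (\<Sum>(u, w)\<leftarrow>xs. tensor sV sG u (m b w))"
      unfolding xs(2) linear_on_sum_list[OF act_linear vector_space_tscale tensor_in_space[OF UNIV_I UNIV_I]]
        act_tensor ..
    also have "\<dots> \<in> VB"
      using xs(1) mB[OF b] by (intro sum_list_in_space tensor_in_space UNIV_I) blast
    finally show ?thesis .
  qed
  then show "?act b ` VB \<subseteq> VB" by blast
  show "twist d (?act b F) = ?act b (twist d F)" if "F \<in> H" for F
    using act_twist[OF d dm] that induced_space_subset by blast
  show "?act b ` H \<subseteq> H"
  proof
    fix X assume "X \<in> ?act b ` H"
    then obtain F where F: "F \<in> H" "X = ?act b F" by blast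
    have "twist d F \<in> VB" by (rule twist_induced_space[OF d dB F(1)])
    then have "twist c (?act b (twist d F)) \<in> H" by (intro twist_in_induced_space[OF c cL] act_VB)
    also have "twist c (?act b (twist d F)) = ?act b (twist c (twist d F))"
      by (rule act_twist[OF c cm twist_in])
    also have "twist c (twist d F) = F"
      using twist_twist[OF c d cd] F(1) induced_space_subset by blast
    finally show "X \<in> H" unfolding F(2) .
  qed
qed

end

context quantum_subgroup
begin

text \<open>
  Coassociativity puts \<open>L f\<close> into the induced space. Conversely, applying \<open>\<epsilon>\<close> to the first
  factor of \<open>k \<otimes> L f = \<Delta> k \<otimes> f\<close> recovers an element of the induced space from its image under \<open>\<epsilon> \<otimes> id\<close>.
\<close>

lemma left_coaction_iso:
  "vs_iso sG UNIV tscale (induced_space sG \<Delta>G sK \<pi> sK \<Delta>K) (left_coaction sG \<Delta>G sK \<pi>)"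
proof -
  interpret reg: right_corepresentation sK sK \<Delta>K \<epsilon>K \<Delta>K by (rule K.regular_corepresentation)
  interpret induced_corepresentation sG \<Delta>G \<epsilon>G SG sK \<Delta>K \<epsilon>K SK \<pi> sK \<Delta>K ..
  let ?T = "tensor sK sG" and ?T3 = "tensor sK tscale"
  let ?ev = "tensor_sum sK sG (\<lambda>k f. sG (\<epsilon>K k) f)"
  have coact: "reg.coact_sum h k = K.sweedler h k" for h :: "'h \<Rightarrow> 'h \<Rightarrow> 'w::ab_group_add" and k
    unfolding K.sweedler_eq_coact_sum ..
  have ev_bil: "bilinear_map sK sG sG (\<lambda>k f. sG (\<epsilon>K k) f)"
    by (rule V_multilinear)+
  have L_in: "L f \<in> VG" for f
    unfolding left_coaction_eq G.sweedler_def by (intro tensor_sum_in_space tensor_in_space UNIV_I)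
  have ev_L: "?ev (L f) = f" for f
  proof -
    have "?ev (L f) = G.sweedler (\<lambda>x y. sG (\<epsilon>K (\<pi> x)) y) f"
      unfolding left_coaction_eq G.sweedler_def by (rule tensor_sum_collapse[OF ev_bil])
    also have "\<dots> = f"
      unfolding proj_counit by (rule G.sweedler_counit_left) (rule multilinear)
    finally show ?thesis .
  qed
  have L_H: "L f \<in> H" for f
  proof -
    have b1: "bilinear_map sK sG tscale (\<lambda>v f. ?T3 v (L f))"
      by (rule V_multilinear linear_comp[OF left_coaction_linear])+
    have b2: "bilinear_map sK sG tscale (\<lambda>v f. reg.coact_sum (\<lambda>w k. ?T3 w (?T k f)) v)"
      by (rule V_multilinear)+
    have b3: "bilinear_map sK sK tscale (\<lambda>w k. ?T3 w (?T k y))" for y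
      by (rule V_multilinear)+
    have tens: "Vector_Spaces.linear tscale tscale (?T3 w)" for w
      using bilinear_map_tensor[OF K.vector_space_axioms vector_space_tscale] unfolding bilinear_map_def by blast
    have "tensor_sum sK sG (\<lambda>v f. ?T3 v (L f)) (L f) = G.sweedler (\<lambda>x y. ?T3 (\<pi> x) (L y)) f"
      unfolding left_coaction_eq[of f] G.sweedler_def by (rule tensor_sum_collapse[OF b1])
    also have "\<dots> = G.sweedler (\<lambda>x y. G.sweedler (\<lambda>u w. ?T3 (\<pi> x) (?T (\<pi> u) w)) y) f"
      unfolding left_coaction_eq G.linear_sweedler[OF tens] ..
    also have "\<dots> = G.sweedler (\<lambda>x y. G.sweedler (\<lambda>u w. ?T3 (\<pi> u) (?T (\<pi> w) y)) x) f"
      by (rule G.sweedler_coassoc[symmetric, where s=tscale]; (rule V_multilinear)+)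
    also have "\<dots> = G.sweedler (\<lambda>x y. K.sweedler (\<lambda>w k. ?T3 w (?T k y)) (\<pi> x)) f"
      by (simp only: sweedler_proj[OF b3])
    also have "\<dots> = tensor_sum sK sG (\<lambda>v f. reg.coact_sum (\<lambda>w k. ?T3 w (?T k f)) v) (L f)"
      using tensor_sum_collapse[OF b2, of sG sG "\<lambda>x y. \<pi> x" "\<lambda>x y. y" "\<Delta>G f"]
      by (simp only: left_coaction_eq G.sweedler_def coact)
    finally show ?thesis unfolding induced_space_iff using L_in by blast
  qed
  have L_ev: "L (?ev F) = F" if F: "F \<in> H" for F
  proof -
    have L2: "L (sG (\<epsilon>K v) f) = G.sweedler (\<lambda>x y. tscale (\<epsilon>K v) (?T (\<pi> x) y)) f" for v f
      unfolding linear_scale[OF left_coaction_linear]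
      unfolding left_coaction_eq by (rule G.linear_sweedler[OF tensor.linear_scale_self])
    have "L (?ev F) = tensor_sum sK sG (\<lambda>v f. G.sweedler (\<lambda>x y. tscale (\<epsilon>K v) (?T (\<pi> x) y)) f) F"
      unfolding linear_tensor_sum[OF left_coaction_linear] L2 ..
    also have "\<dots> = tensor_sum sK sG (\<lambda>v f. reg.coact_sum (\<lambda>w k. tscale (\<epsilon>K w) (?T k f)) v) F"
      by (rule induced_space_trilinear[OF F];
          (rule V_multilinear linear_bilinear_left[OF bilinear_scale[OF vector_space_tscale]]
            linear_bilinear_right[OF bilinear_scale[OF vector_space_tscale]])+)
    also have "\<dots> = tensor_sum sK sG (\<lambda>v f. ?T v f) F"
    proof -
      have "K.sweedler (\<lambda>w k. tscale (\<epsilon>K w) (?T k f)) v = ?T v f" for v f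
        by (rule K.sweedler_counit_left) (rule V_multilinear)+
      then show ?thesis unfolding coact by simp
    qed
    also have "\<dots> = F"
      using tensor_sum_tensor[OF K.vector_space_axioms G.vector_space_axioms] F induced_space_subset by blast
    finally show ?thesis .
  qed
  have "bij_betw L UNIV H"
    by (rule bij_betw_byWitness[where f' = ?ev]) (use ev_L L_ev L_H in blast)+
  then show ?thesis
    unfolding vs_iso_def linear_on_def
    using linear_add[OF left_coaction_linear] linear_scale[OF left_coaction_linear] by blast
qed

end


section \<open>The isomorphisms\<close>

locale cleft_induction =
  cleft_invertible_antipode sG \<Delta>G \<epsilon>G SG sK \<Delta>K \<epsilon>K SK \<pi> \<phi> \<psi> +
  induced_corepresentation sG \<Delta>G \<epsilon>G SG sK \<Delta>K \<epsilon>K SK \<pi> sV \<rho>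
  for sG :: "'k::field \<Rightarrow> 'g::ring_1 \<Rightarrow> 'g" and \<Delta>G \<epsilon>G SG
    and sK :: "'k \<Rightarrow> 'h::ring_1 \<Rightarrow> 'h" and \<Delta>K \<epsilon>K SK and \<pi> and \<phi> \<psi>
    and sV :: "'k \<Rightarrow> 'v::ab_group_add \<Rightarrow> 'v" and \<rho>
begin

lemma linear_mult_left: "Vector_Spaces.linear sG sG (\<lambda>x. x * y)"
  and linear_mult_right: "Vector_Spaces.linear sG sG (\<lambda>y. x * y)"
  using G.bilinear_mult unfolding bilinear_map_def by blast+

lemma right_module_iso: "module_iso B (act_right sV sG) H VB (twist (\<lambda>k f. \<psi> k * f))"
proof -
  note rules = full_multilinear
  have "module_iso B (\<lambda>b. tensor_map sV sG sV sG id (\<lambda>f. f * b)) H VB (twist (\<lambda>k f. \<psi> k * f))"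
  proof (rule twist_module_iso[where c = "\<lambda>k f. \<phi> k * f"])
    show "bilinear_map sK sG sG (\<lambda>k f. \<phi> k * f)" "bilinear_map sK sG sG (\<lambda>k f. \<psi> k * f)"
      "bilinear_map sG sG sG (\<lambda>b f. f * b)"
      by (rule rules)+
    show "K.sweedler (\<lambda>x y. \<phi> x * (\<psi> y * f)) k = sG (\<epsilon>K k) f" for k f
      using sweedler_section_inverse[OF linear_mult_left] by (simp add: mult.assoc)
    show "K.sweedler (\<lambda>x y. \<psi> x * (\<phi> y * f)) k = sG (\<epsilon>K k) f" for k f
      using sweedler_inverse_section[OF linear_mult_left] by (simp add: mult.assoc)
    show "G.sweedler (\<lambda>x y. \<psi> (\<pi> x) * y) f \<in> B" for f by (rule inverse_proj_coinvariant)
    show "b' * b \<in> B" if "b \<in> B" "b' \<in> B" for b b' using coinvariants_mult that by blast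
    fix k b assume b: "b \<in> B"
    have "L (\<phi> k * b) = G.sweedler (\<lambda>x y. G.sweedler (\<lambda>u w. tensor sK sG (\<pi> (x * u)) (y * w)) b) (\<phi> k)"
      unfolding left_coaction_eq by (rule G.sweedler_mult) (rule rules)+
    also have "\<dots> = G.sweedler (\<lambda>x y. tensor sK sG (\<pi> x * 1) (y * b)) (\<phi> k)"
      unfolding proj_mult by (rule G.sweedler_cong, rule sweedler_coinvariant[OF b]) (rule rules)+
    also have "\<dots> = K.sweedler (\<lambda>x y. tensor sK sG (x * 1) (\<phi> y * b)) k"
      by (rule sweedler_section) (rule rules)+
    finally show "L (\<phi> k * b) = K.sweedler (\<lambda>x y. tensor sK sG x (\<phi> y * b)) k" by simp
  qed (simp_all only: mult.assoc)
  then show ?thesis unfolding module_iso_def act_right_def .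
qed

text \<open>
  Multiplying by the factor from the quotient on the right composes two twists in the opposite order.
  Precomposition with \<open>SK_inv\<close> reverses coproducts and so restores the convolution identities, and
  it exchanges the roles of \<open>\<phi>\<close> and \<open>\<psi>\<close>: the colinear one of the two is now \<open>\<psi> \<circ> SK_inv\<close>.
\<close>

lemma left_module_iso: "module_iso B (act_left sV sG) H VB (twist (\<lambda>k f. f * \<phi> (SK_inv k)))"
proof -
  note rules = full_multilinear
  have opp: "K.sweedler (\<lambda>x y. \<psi> (SK_inv y) * \<phi> (SK_inv x)) k = sG (\<epsilon>K k) 1"
    "K.sweedler (\<lambda>x y. \<phi> (SK_inv y) * \<psi> (SK_inv x)) k = sG (\<epsilon>K k) 1" for k
  proof -
    have "K.sweedler (\<lambda>x y. \<psi> x * \<phi> y) (SK_inv k) = K.sweedler (\<lambda>x y. \<psi> (SK_inv y) * \<phi> (SK_inv x)) k"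
      by (rule sweedler_SK_inv) (rule rules)+
    then show "K.sweedler (\<lambda>x y. \<psi> (SK_inv y) * \<phi> (SK_inv x)) k = sG (\<epsilon>K k) 1"
      by (simp only: inverse_section counit_SK_inv)
    have "K.sweedler (\<lambda>x y. \<phi> x * \<psi> y) (SK_inv k) = K.sweedler (\<lambda>x y. \<phi> (SK_inv y) * \<psi> (SK_inv x)) k"
      by (rule sweedler_SK_inv) (rule rules)+
    then show "K.sweedler (\<lambda>x y. \<phi> (SK_inv y) * \<psi> (SK_inv x)) k = sG (\<epsilon>K k) 1"
      by (simp only: section_inverse counit_SK_inv)
  qed
  have "module_iso B (\<lambda>b. tensor_map sV sG sV sG id (\<lambda>f. b * f)) H VB (twist (\<lambda>k f. f * \<phi> (SK_inv k)))"
  proof (rule twist_module_iso[where c = "\<lambda>k f. f * \<psi> (SK_inv k)"])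
    show "bilinear_map sK sG sG (\<lambda>k f. f * \<psi> (SK_inv k))" "bilinear_map sK sG sG (\<lambda>k f. f * \<phi> (SK_inv k))"
      "bilinear_map sG sG sG (\<lambda>b f. b * f)"
      by (rule rules)+
    show "K.sweedler (\<lambda>x y. f * \<phi> (SK_inv y) * \<psi> (SK_inv x)) k = sG (\<epsilon>K k) f" for k f
      using K.linear_sweedler[OF linear_mult_right, of f "\<lambda>x y. \<phi> (SK_inv y) * \<psi> (SK_inv x)" k]
      by (simp add: opp mult.assoc G.scale_mult_right)
    show "K.sweedler (\<lambda>x y. f * \<psi> (SK_inv y) * \<phi> (SK_inv x)) k = sG (\<epsilon>K k) f" for k f
      using K.linear_sweedler[OF linear_mult_right, of f "\<lambda>x y. \<psi> (SK_inv y) * \<phi> (SK_inv x)" k]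
      by (simp add: opp mult.assoc G.scale_mult_right)
    show "G.sweedler (\<lambda>x y. y * \<phi> (SK_inv (\<pi> x))) f \<in> B" for f by (rule section_SK_inv_proj_coinvariant)
    show "b * b' \<in> B" if "b \<in> B" "b' \<in> B" for b b' using coinvariants_mult that by blast
    fix k b assume b: "b \<in> B"
    have "L (b * \<psi> (SK_inv k))
      = G.sweedler (\<lambda>x y. G.sweedler (\<lambda>u w. tensor sK sG (\<pi> (x * u)) (y * w)) (\<psi> (SK_inv k))) b"
      unfolding left_coaction_eq by (rule G.sweedler_mult) (rule rules)+
    also have "\<dots> = G.sweedler (\<lambda>u w. tensor sK sG (1 * \<pi> u) (b * w)) (\<psi> (SK_inv k))"
      unfolding proj_mult by (rule sweedler_coinvariant[OF b]) (rule rules)+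
    also have "\<dots> = K.sweedler (\<lambda>x y. tensor sK sG (1 * x) (b * \<psi> (SK_inv y))) k"
      by (rule inverse_SK_inv_colinear) (rule rules)+
    finally show "L (b * \<psi> (SK_inv k)) = K.sweedler (\<lambda>x y. tensor sK sG x (b * \<psi> (SK_inv y))) k" by simp
  qed (simp_all only: mult.assoc)
  then show ?thesis unfolding module_iso_def act_left_def .
qed

end

theorem proposition4p3:
  fixes sG :: "'k::field_char_0 \<Rightarrow> 'g::ring_1 \<Rightarrow> 'g"
    and \<Delta>G :: "'g \<Rightarrow> ('g, 'g, 'k) tensor" and \<epsilon>G :: "'g \<Rightarrow> 'k" and SG :: "'g \<Rightarrow> 'g"
    and sK :: "'k \<Rightarrow> 'h::ring_1 \<Rightarrow> 'h"
    and \<Delta>K :: "'h \<Rightarrow> ('h, 'h, 'k) tensor" and \<epsilon>K :: "'h \<Rightarrow> 'k" and SK :: "'h \<Rightarrow> 'h"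
    and \<pi> :: "'g \<Rightarrow> 'h"
    and sV :: "'k \<Rightarrow> 'v::ab_group_add \<Rightarrow> 'v" and \<rho> :: "'v \<Rightarrow> ('v, 'h, 'k) tensor"
    and \<phi> :: "'h \<Rightarrow> 'g"
  assumes "hopf_algebra sG \<Delta>G \<epsilon>G SG" and "bij SG"
    and "quantum_subgroup sG \<Delta>G \<epsilon>G SG sK \<Delta>K \<epsilon>K SK \<pi>"
    and "right_corepresentation sV sK \<Delta>K \<epsilon>K \<rho>"
    and "left_section sG \<Delta>G sK \<Delta>K \<epsilon>K \<pi> \<phi>"
  shows "(\<exists>\<Psi>. vs_iso sG UNIV tscale (tensor_space sK sG UNIV (coinvariants sG \<Delta>G sK \<pi>)) \<Psi>) \<and>
    (\<exists>\<Phi>. module_iso (coinvariants sG \<Delta>G sK \<pi>) (act_left sV sG)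
        (induced_space sG \<Delta>G sK \<pi> sV \<rho>) (tensor_space sV sG UNIV (coinvariants sG \<Delta>G sK \<pi>)) \<Phi>) \<and>
    (\<exists>\<Phi>. module_iso (coinvariants sG \<Delta>G sK \<pi>) (act_right sV sG)
        (induced_space sG \<Delta>G sK \<pi> sV \<rho>) (tensor_space sV sG UNIV (coinvariants sG \<Delta>G sK \<pi>)) \<Phi>)"
proof -
  interpret quantum_subgroup sG \<Delta>G \<epsilon>G SG sK \<Delta>K \<epsilon>K SK \<pi> by (rule assms(3))
  obtain \<psi> where cleft: "cleft_quantum_subgroup sG \<Delta>G \<epsilon>G SG sK \<Delta>K \<epsilon>K SK \<pi> \<phi> \<psi>"
    using left_section_cleft[OF assms(5)] .
  have bij: "hopf_algebra_invertible_antipode sG \<Delta>G \<epsilon>G SG"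
    using assms(1,2)
    by (simp only: hopf_algebra_invertible_antipode_def hopf_algebra_invertible_antipode_axioms_def simp_thms)
  have induction: "cleft_induction sG \<Delta>G \<epsilon>G SG sK \<Delta>K \<epsilon>K SK \<pi> \<phi> \<psi> sW \<sigma>"
    if "right_corepresentation sW sK \<Delta>K \<epsilon>K \<sigma>"
    for sW :: "'k \<Rightarrow> 'w::ab_group_add \<Rightarrow> 'w" and \<sigma>
    unfolding cleft_induction_def cleft_invertible_antipode_def induced_corepresentation_def
    using cleft bij assms(3) that by blast
  note regular = cleft_induction.right_module_iso[OF induction[OF K.regular_corepresentation]]
  show ?thesis
    using vs_iso_comp[OF left_coaction_iso regular[unfolded module_iso_def, THEN conjunct1]]
      cleft_induction.left_module_iso[OF induction[OF assms(4)]]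
      cleft_induction.right_module_iso[OF induction[OF assms(4)]]
    by blast
qed

end
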